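(* Let $\mathfrak{g}$ be the $8$-dimensional real Lie algebra with basis $\{x_1,y_1,x_2,y_2,x_3,y_3,x_4,y_4\}$ whose non-zero brackets (up to antisymmetry) are $$[x_1,y_1]=y_2,\qquad [x_1,x_k]=[y_1,y_k]=x_{k+1},\qquad [x_1,y_k]=-[y_1,x_k]=y_{k+1}\qquad (k=2,3),$$ with the abelian complex structure $Jx_j=y_j$, $Jy_j=-x_j$ ($1\le j\le 4$), and let $v_j=\tfrac12(x_j-iy_j)$. Let $M=G/\Gamma$ be a nilmanifold, with the induced complex structure, where $G$ is the simply connected Lie group with Lie algebra $\mathfrak{g}$ and $\Gamma$ is a lattice in $G$. Then for the invariant holomorphic Poisson structure $\Pi=2v_1\wedge v_4-v_2\wedge v_3$ on $M$, the spectral sequence of the holomorphic Poisson bi-complex associated to $\Pi$ does not degenerate at its second level.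
   Context: The quotient $M=G/\Gamma$ is taken so that left-invariant tensors on $G$ descend to $M$. A left-invariant complex structure $J$ is abelian if $[JA,JB]=[A,B]$ for all $A,B\in\mathfrak{g}$. The vectors $v_1,\dots,v_4$ form a basis of $\mathfrak{g}^{1,0}$, the $+i$ eigenspace of $J$ on $\mathfrak{g}_{\mathbb C}$. On a complex manifold $M$, put $A^{p,q}=C^\infty(M,\wedge^pTM^{1,0}\otimes\wedge^qTM^{*(0,1)})$ and $K^n=\bigoplus_{p+q=n}A^{p,q}$. The operator $\overline\partial:A^{p,q}\to A^{p,q+1}$ is the Dolbeault operator with values in polyvector fields. The Schouten bracket on $\bigoplus_nK^n$ extends the bracket on $TM^{1,0}\oplus TM^{*(0,1)}$ for which $[X,Y]$ is the Lie bracket of vector fields, $[X,\omega]$ is the Lie derivative of the 1-form $\omega$ along $X$, and $[\omega,\rho]=0$ for 1-forms. A holomorphic Poisson structure is $\Lambda\in C^\infty(M,\wedge^2TM^{1,0})$ with $\overline\partial\Lambda=0$ and $[\Lambda,\Lambda]=0$; put $\mathrm{ad}_\Lambda=[\Lambda,\cdot]:A^{p,q}\to A^{p+1,q}$. The Poisson bi-complex of $\Lambda$ is $(A^{p,q},\mathrm{ad}_\Lambda,\overline\partial)$; its spectral sequence is the one of the filtration $F^pK^n=\bigoplus_{p'+q=n,\,p'\ge p}A^{p',q}$, so that $d_0=\overline\partial$, $E_1^{p,q}=H^q(M,\Theta^p)$ (Dolbeault cohomology with coefficients in holomorphic $p$-vector fields), $d_1=\mathrm{ad}_\Lambda$, and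 $d_r:E_r^{p,q}\to E_r^{p+r,q-r+1}$. It degenerates at the second level if $d_r=0$ for all $r\ge 2$. *)

theory Defs
  imports "HOL-Analysis.Analysis" "HOL-Library.Function_Algebras"
begin

section \<open>The Lie algebra, its complexification and the complex structure\<close>

text \<open>
  The pair \<open>(a, b)\<close> stands for \<open>\<Sum>j. a\<^sub>j x\<^sub>j + b\<^sub>j y\<^sub>j\<close>.  At \<open>'k = real\<close> this is the Lie algebra
  itself, at \<open>'k = complex\<close> its complexification.  Basis vectors are indexed by natural
  numbers \<open>1, \<dots>, 4\<close>; in the index type \<open>4\<close> the numeral \<open>4\<close> equals \<open>0\<close>.
\<close>

type_synonym 'k lie = "('k ^ 4) \<times> ('k ^ 4)"

definition xvec :: "nat \<Rightarrow> 'k::comm_ring_1 lie" where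
  "xvec j = (axis (of_nat j) 1, 0)"

definition yvec :: "nat \<Rightarrow> 'k::comm_ring_1 lie" where
  "yvec j = (0, axis (of_nat j) 1)"

text \<open>The bilinear extension of the bracket table; see \<open>lie_br_table\<close>.\<close>

definition lie_br :: "'k::comm_ring_1 lie \<Rightarrow> 'k lie \<Rightarrow> 'k lie" where
  "lie_br u w =
    (let a = fst u; b = snd u; c = fst w; d = snd w;
         xc = (\<lambda>k. (a$1 * c$k - a$k * c$1) + (b$1 * d$k - b$k * d$1));
         yc = (\<lambda>k. (a$1 * d$k - b$k * c$1) - (b$1 * c$k - a$k * d$1))
     in ((\<chi> i. if i = 3 then xc 2 else if i = 4 then xc 3 else 0),
         (\<chi> i. if i = 2 then a$1 * d$1 - b$1 * c$1
               else if i = 3 then yc 2 else if i = 4 then yc 3 else 0)))"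

definition Jop :: "'k::comm_ring_1 lie \<Rightarrow> 'k lie" where
  "Jop u = (- snd u, fst u)"

definition lie_scale :: "'k::comm_ring_1 \<Rightarrow> 'k lie \<Rightarrow> 'k lie" where
  "lie_scale c u = (c *s fst u, c *s snd u)"

definition vvec :: "nat \<Rightarrow> complex lie" where
  "vvec j = lie_scale (1/2) (xvec j - lie_scale \<i> (yvec j))"

definition vbar :: "nat \<Rightarrow> complex lie" where
  "vbar j = lie_scale (1/2) (xvec j + lie_scale \<i> (yvec j))"

text \<open>The basis of \<open>\<gg>\<^sub>\<complex>\<^sup>*\<close> dual to \<open>v\<^sub>1, \<dots>, v\<^sub>4\<close> and their conjugates.\<close>

definition om :: "nat \<Rightarrow> complex lie \<Rightarrow> complex" where
  "om j u = fst u $ of_nat j + \<i> * snd u $ of_nat j"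

definition ombar :: "nat \<Rightarrow> complex lie \<Rightarrow> complex" where
  "ombar j u = fst u $ of_nat j - \<i> * snd u $ of_nat j"

lemma lie_eqI:
  fixes u w :: "'k lie"
  assumes "fst u $ 1 = fst w $ 1" "fst u $ 2 = fst w $ 2" "fst u $ 3 = fst w $ 3" "fst u $ 4 = fst w $ 4"
    and "snd u $ 1 = snd w $ 1" "snd u $ 2 = snd w $ 2" "snd u $ 3 = snd w $ 3" "snd u $ 4 = snd w $ 4"
  shows "u = w"
  using assms by (auto simp: prod_eq_iff vec_eq_iff forall_4)

lemma lie_br_nth [simp]:
  "fst (lie_br u w) $ 1 = 0"
  "fst (lie_br u w) $ 2 = 0"
  "fst (lie_br u w) $ 3 = (fst u$1 * fst w$2 - fst u$2 * fst w$1) + (snd u$1 * snd w$2 - snd u$2 * snd w$1)"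
  "fst (lie_br u w) $ 4 = (fst u$1 * fst w$3 - fst u$3 * fst w$1) + (snd u$1 * snd w$3 - snd u$3 * snd w$1)"
  "snd (lie_br u w) $ 1 = 0"
  "snd (lie_br u w) $ 2 = fst u$1 * snd w$1 - snd u$1 * fst w$1"
  "snd (lie_br u w) $ 3 = (fst u$1 * snd w$2 - snd u$2 * fst w$1) - (snd u$1 * fst w$2 - fst u$2 * snd w$1)"
  "snd (lie_br u w) $ 4 = (fst u$1 * snd w$3 - snd u$3 * fst w$1) - (snd u$1 * fst w$3 - fst u$3 * snd w$1)"
  by (simp_all add: lie_br_def Let_def)

lemma lie_br_table:
  fixes x y :: "nat \<Rightarrow> 'k::comm_ring_1 lie"
  defines "x \<equiv> xvec" and "y \<equiv> yvec"
  shows "lie_br (x 1) (y 1) = y 2"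
    "lie_br (x 1) (x 2) = x 3" "lie_br (x 1) (x 3) = x 4" "lie_br (x 1) (x 4) = 0"
    "lie_br (y 1) (y 2) = x 3" "lie_br (y 1) (y 3) = x 4" "lie_br (y 1) (y 4) = 0"
    "lie_br (x 1) (y 2) = y 3" "lie_br (x 1) (y 3) = y 4" "lie_br (x 1) (y 4) = 0"
    "lie_br (y 1) (x 2) = - y 3" "lie_br (y 1) (x 3) = - y 4" "lie_br (y 1) (x 4) = 0"
    "j \<in> {2,3,4} \<Longrightarrow> k \<in> {2,3,4} \<Longrightarrow> lie_br (x j) (x k) = 0"
    "j \<in> {2,3,4} \<Longrightarrow> k \<in> {2,3,4} \<Longrightarrow> lie_br (x j) (y k) = 0"
    "j \<in> {2,3,4} \<Longrightarrow> k \<in> {2,3,4} \<Longrightarrow> lie_br (y j) (y k) = 0"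
  by (rule lie_eqI; auto simp: x_def y_def xvec_def yvec_def axis_def)+

lemma lie_br_self: "lie_br u u = 0"
  by (rule lie_eqI) auto

lemma lie_br_jacobi:
  "lie_br u (lie_br v w) + lie_br v (lie_br w u) + lie_br w (lie_br u v) = 0"
  by (rule lie_eqI; simp add: algebra_simps)

lemma lie_br_nilpotent: "lie_br u1 (lie_br u2 (lie_br u3 (lie_br u4 u5))) = 0"
  by (rule lie_eqI; simp)

lemma Jop_abelian: "Jop (Jop u) = - u" "lie_br (Jop u) (Jop w) = lie_br u w"
  by (rule lie_eqI; simp add: Jop_def algebra_simps)+

lemma Jop_basis: "Jop (xvec j) = yvec j" "Jop (yvec j) = - xvec j"
  by (simp_all add: Jop_def xvec_def yvec_def)

lemma Jop_eigen: "Jop (vvec j) = lie_scale \<i> (vvec j)" "Jop (vbar j) = lie_scale (- \<i>) (vbar j)"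
  by (rule lie_eqI; simp add: Jop_def vvec_def vbar_def lie_scale_def xvec_def yvec_def)+

lemma om_dual:
  assumes "j \<in> {1..4}" "k \<in> {1..4}"
  shows "om j (vvec k) = (if j = k then 1 else 0)" "om j (vbar k) = 0"
    "ombar j (vbar k) = (if j = k then 1 else 0)" "ombar j (vvec k) = 0"
proof -
  have "(of_nat j :: 4) = of_nat k \<longleftrightarrow> j = k"
  proof -
    have "{1..4} = {1,2,3,4::nat}" by auto
    then show ?thesis using assms by auto
  qed
  then show "om j (vvec k) = (if j = k then 1 else 0)" "om j (vbar k) = 0"
    "ombar j (vbar k) = (if j = k then 1 else 0)" "ombar j (vvec k) = 0"
    by (auto simp: om_def ombar_def vvec_def vbar_def lie_scale_def xvec_def yvec_def axis_def)
qed


section \<open>The simply connected group and the nilmanifold\<close>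

text \<open>
  The simply connected Lie group of a nilpotent Lie algebra is the Lie algebra itself, as a
  manifold, with the Baker--Campbell--Hausdorff product; the exponential map is the identity.
  The series stops after the terms of order four since the Lie algebra is \<open>4\<close>-step nilpotent.
\<close>

definition bch :: "real lie \<Rightarrow> real lie \<Rightarrow> real lie" where
  "bch u w = u + w + (1/2) *\<^sub>R lie_br u w
     + (1/12) *\<^sub>R (lie_br u (lie_br u w) + lie_br w (lie_br w u))
     - (1/24) *\<^sub>R lie_br w (lie_br u (lie_br u w))"

lemma bch_0 [simp]: "bch 0 u = u" "bch u 0 = u"
  by (rule lie_eqI; simp add: bch_def)+

lemma bch_minus [simp]: "bch (- u) u = 0" "bch u (- u) = 0"
  by (rule lie_eqI; simp add: bch_def algebra_simps)+

lemma bch_assoc: "bch (bch u v) w = bch u (bch v w)"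
  by (rule lie_eqI; simp add: bch_def field_simps)

text \<open>
  A lattice \<open>\<Gamma>\<close> is a discrete subgroup with compact quotient.  The quotient is by left
  translations by elements of \<open>\<Gamma>\<close>, so that left-invariant tensors descend to it.
\<close>

definition cocompact_lattice :: "real lie set \<Rightarrow> bool" where
  "cocompact_lattice \<Gamma> \<longleftrightarrow>
     0 \<in> \<Gamma> \<and> (\<forall>a\<in>\<Gamma>. \<forall>b\<in>\<Gamma>. bch a b \<in> \<Gamma>) \<and> (\<forall>a\<in>\<Gamma>. - a \<in> \<Gamma>) \<and>
     discrete \<Gamma> \<and>
     (\<exists>K. compact K \<and> (\<forall>g. \<exists>\<gamma>\<in>\<Gamma>. \<exists>k\<in>K. g = bch \<gamma> k))"

fun Ck :: "nat \<Rightarrow> (real lie \<Rightarrow> complex) \<Rightarrow> bool" where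
  "Ck 0 f \<longleftrightarrow> continuous_on UNIV f"
| "Ck (Suc k) f \<longleftrightarrow> (\<forall>g. f differentiable at g) \<and> (\<forall>u. Ck k (\<lambda>g. frechet_derivative f (at g) u))"

text \<open>\<open>C\<^sup>\<infinity>\<close>-functions on the nilmanifold, as \<open>\<Gamma>\<close>-invariant functions on the group.\<close>

definition smooth_fun :: "real lie set \<Rightarrow> (real lie \<Rightarrow> complex) \<Rightarrow> bool" where
  "smooth_fun \<Gamma> f \<longleftrightarrow> (\<forall>k. Ck k f) \<and> (\<forall>\<gamma>\<in>\<Gamma>. \<forall>g. f (bch \<gamma> g) = f g)"

text \<open>The left-invariant vector field with value \<open>u\<close> at the unit, acting on functions.\<close>

definition lderiv :: "real lie \<Rightarrow> (real lie \<Rightarrow> complex) \<Rightarrow> real lie \<Rightarrow> complex" where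
  "lderiv u f g = vector_derivative (\<lambda>t. f (bch g (t *\<^sub>R u))) (at 0)"

definition cderiv :: "complex lie \<Rightarrow> (real lie \<Rightarrow> complex) \<Rightarrow> real lie \<Rightarrow> complex" where
  "cderiv w f g = (\<Sum>j=1..4. fst w $ of_nat j * lderiv (xvec j) f g
                          + snd w $ of_nat j * lderiv (yvec j) f g)"

text \<open>
  In the coordinates of the group, the left-invariant field of \<open>u\<close> is \<open>linv u\<close>; the last lemma says
  that the commutator of the fields of \<open>u\<close> and \<open>w\<close> is the field of \<open>lie_br u w\<close>.
\<close>

definition linv :: "real lie \<Rightarrow> real lie \<Rightarrow> real lie" where
  "linv u g = u + (1/2) *\<^sub>R lie_br g u + (1/12) *\<^sub>R lie_br g (lie_br g u)"

lemma bch_has_vector_derivative: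
  "((\<lambda>t. bch g (t *\<^sub>R u)) has_vector_derivative linv u g) (at 0)"
proof -
  have eq: "bch g (t *\<^sub>R u) = g + t *\<^sub>R linv u g
      + t\<^sup>2 *\<^sub>R ((1/12) *\<^sub>R lie_br u (lie_br u g) - (1/24) *\<^sub>R lie_br u (lie_br g (lie_br g u)))" for t
    by (rule lie_eqI; simp add: bch_def linv_def field_simps power2_eq_square)
  show ?thesis
    unfolding eq by (auto intro!: derivative_eq_intros)
qed

lemma lie_br_bounded_bilinear: "bounded_bilinear (lie_br :: real lie \<Rightarrow> real lie \<Rightarrow> real lie)"
proof -
  have "bilinear (lie_br :: real lie \<Rightarrow> real lie \<Rightarrow> real lie)"
    unfolding bilinear_def
    by (intro conjI allI linearI) (rule lie_eqI; simp add: algebra_simps)+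
  then show ?thesis by (simp add: bilinear_conv_bounded_bilinear)
qed

definition linv_deriv :: "real lie \<Rightarrow> real lie \<Rightarrow> real lie \<Rightarrow> real lie" where
  "linv_deriv u g h =
     (1/2) *\<^sub>R lie_br h u + (1/12) *\<^sub>R (lie_br g (lie_br h u) + lie_br h (lie_br g u))"

lemma linv_has_derivative: "(linv u has_derivative linv_deriv u g) (at g)"
proof -
  interpret bounded_bilinear "lie_br :: real lie \<Rightarrow> real lie \<Rightarrow> real lie"
    by (rule lie_br_bounded_bilinear)
  have 0: "lie_br x (0::real lie) = 0" for x by (rule lie_eqI; simp)
  have "((\<lambda>g. u + (1/2) *\<^sub>R lie_br g u + (1/12) *\<^sub>R lie_br g (lie_br g u))
          has_derivative linv_deriv u g) (at g)"
    unfolding linv_deriv_def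
    by (auto intro!: derivative_eq_intros FDERIV simp: 0)
  then show ?thesis by (simp add: linv_def[abs_def])
qed

lemma linv_commutator:
  "linv_deriv w g (linv u g) - linv_deriv u g (linv w g) = linv (lie_br u w) g"
  by (rule lie_eqI; simp add: linv_def linv_deriv_def field_simps)


section \<open>Polyvector-valued forms on the nilmanifold\<close>

text \<open>
  The left-invariant frame \<open>v\<^sub>1, \<dots>, v\<^sub>4\<close> of \<open>TM\<^sup>1\<^sup>,\<^sup>0\<close> and its conjugate dual frame of
  \<open>TM\<^sup>*\<^sup>(\<^sup>0\<^sup>,\<^sup>1\<^sup>)\<close> are global.  They are numbered as generators \<open>1, \<dots>, 4\<close> and \<open>5, \<dots>, 8\<close>.  A section
  of the exterior algebra of the sum of the two bundles is the family of its coefficients: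
  \<open>\<alpha> S\<close> is the coefficient function of the wedge product, in increasing order, of the generators
  in \<open>S \<subseteq> {1..8}\<close>.
\<close>

type_synonym kfield = "nat set \<Rightarrow> real lie \<Rightarrow> complex"

definition gen :: "nat \<Rightarrow> kfield" where
  "gen a = (\<lambda>S g. if S = {a} then 1 else 0)"

definition smul :: "complex \<Rightarrow> kfield \<Rightarrow> kfield" where
  "smul c \<alpha> = (\<lambda>S g. c * \<alpha> S g)"

definition wedge :: "kfield \<Rightarrow> kfield \<Rightarrow> kfield" (infixr "\<and>\<^sub>K" 72) where
  "\<alpha> \<and>\<^sub>K \<beta> = (\<lambda>S g. \<Sum>T\<in>Pow S.
      (-1) ^ card {(i, j). i \<in> T \<and> j \<in> S - T \<and> j < i} * (\<alpha> T g * \<beta> (S - T) g))"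

text \<open>Contraction with the dual of the generator \<open>a\<close>, from the left and from the right.\<close>

definition lcontr :: "nat \<Rightarrow> kfield \<Rightarrow> kfield" where
  "lcontr a \<alpha> = (\<lambda>S g. if a \<in> S then 0 else (-1) ^ card {i\<in>S. i < a} * \<alpha> (insert a S) g)"

definition rcontr :: "kfield \<Rightarrow> nat \<Rightarrow> kfield" where
  "rcontr \<alpha> a = (\<lambda>S g. if a \<in> S then 0 else (-1) ^ card {i\<in>S. a < i} * \<alpha> (insert a S) g)"

definition act :: "complex lie \<Rightarrow> kfield \<Rightarrow> kfield" where
  "act w \<alpha> = (\<lambda>S. cderiv w (\<alpha> S))"

definition Apq :: "real lie set \<Rightarrow> nat \<Rightarrow> nat \<Rightarrow> kfield set" where
  "Apq \<Gamma> p q = {\<alpha>. (\<forall>S. smooth_fun \<Gamma> (\<alpha> S)) \<and>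
     (\<forall>S. \<alpha> S \<noteq> 0 \<longrightarrow> S \<subseteq> {1..8} \<and> card (S \<inter> {1..4}) = p \<and> card (S \<inter> {5..8}) = q)}"

text \<open>
  The Dolbeault operator is the graded derivation determined by its values on generators: on a
  function \<open>f\<close> it is \<open>\<Sum>j. (vbar j f) ombar j\<close>, on a \<open>(1,0)\<close>-vector \<open>X\<close> it is
  \<open>\<Sum>j. ombar j \<and> [vbar j, X]\<close> with the bracket projected to its \<open>(1,0)\<close>-part, and on a \<open>(0,1)\<close>-form
  it is the \<open>(0,2)\<close>-part of the exterior derivative.  On the left-invariant frame the last two are
  given by the Lie algebra bracket; these are the values of \<open>dbar_gen\<close>.
\<close>

definition dbar_gen :: "nat \<Rightarrow> kfield" where
  "dbar_gen a = (if a \<le> 4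
     then (\<Sum>j=1..4. \<Sum>k=1..4. smul (om k (lie_br (vbar j) (vvec a))) (gen (4 + j) \<and>\<^sub>K gen k))
     else (\<Sum>j=1..4. \<Sum>i\<in>{1..<j}.
             smul (- ombar (a - 4) (lie_br (vbar i) (vbar j))) (gen (4 + i) \<and>\<^sub>K gen (4 + j))))"

definition dbar :: "kfield \<Rightarrow> kfield" where
  "dbar \<alpha> = (\<Sum>j=1..4. gen (4 + j) \<and>\<^sub>K act (vbar j) \<alpha>) + (\<Sum>a=1..8. dbar_gen a \<and>\<^sub>K lcontr a \<alpha>)"

text \<open>
  The bracket of two generators is the Lie bracket for two vectors and zero for two forms.  For a
  vector \<open>v\<close> and a form \<open>\<omega>\<close> it is the Lie derivative, which on the left-invariant frame is
  \<open>Y \<mapsto> - \<omega> [v, Y]\<close>.  The Schouten bracket is the extension with \<open>[X, f] = X f = - [f, X]\<close> for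
  vector fields \<open>X\<close> and functions \<open>f\<close> which satisfies, for \<open>\<alpha>\<close> of degree \<open>m\<close> and \<open>\<beta>\<close> of degree \<open>n\<close>,
  \<open>[\<alpha>, \<beta> \<and> \<gamma>] = [\<alpha>, \<beta>] \<and> \<gamma> + (-1)^((m-1) n) \<beta> \<and> [\<alpha>, \<gamma>]\<close> and
  \<open>[\<alpha>, \<beta>] = - (-1)^((m-1) (n-1)) [\<beta>, \<alpha>]\<close>.
\<close>

definition gen_br :: "nat \<Rightarrow> nat \<Rightarrow> kfield" where
  "gen_br a b =
     (if a \<le> 4 \<and> b \<le> 4 then (\<Sum>k=1..4. smul (om k (lie_br (vvec a) (vvec b))) (gen k))
      else if a \<le> 4 then (\<Sum>k=1..4. smul (- ombar (b - 4) (lie_br (vvec a) (vbar k))) (gen (4 + k)))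
      else if b \<le> 4 then (\<Sum>k=1..4. smul (ombar (a - 4) (lie_br (vvec b) (vbar k))) (gen (4 + k)))
      else 0)"

definition schouten :: "kfield \<Rightarrow> kfield \<Rightarrow> kfield" where
  "schouten \<alpha> \<beta> =
     (\<Sum>a=1..8. \<Sum>b=1..8. rcontr \<alpha> a \<and>\<^sub>K gen_br a b \<and>\<^sub>K lcontr b \<beta>)
     + (\<Sum>a=1..4. rcontr \<alpha> a \<and>\<^sub>K act (vvec a) \<beta>)
     - (\<Sum>b=1..4. act (vvec b) \<alpha> \<and>\<^sub>K lcontr b \<beta>)"

definition holomorphic_poisson :: "real lie set \<Rightarrow> kfield \<Rightarrow> bool" where
  "holomorphic_poisson \<Gamma> \<Lambda> \<longleftrightarrow> \<Lambda> \<in> Apq \<Gamma> 2 0 \<and> dbar \<Lambda> = 0 \<and> schouten \<Lambda> \<Lambda> = 0"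


section \<open>The spectral sequence of a filtered complex\<close>

text \<open>
  \<open>F p n\<close> is the \<open>p\<close>-th step of a decreasing filtration on the degree \<open>n\<close> part of a complex, and
  \<open>D\<close> is the differential.  With \<open>Z\<^sub>r\<^sup>p\<^sup>,\<^sup>q = {x \<in> F\<^sup>p K\<^sup>p\<^sup>+\<^sup>q. D x \<in> F\<^sup>p\<^sup>+\<^sup>r}\<close>, the term \<open>E\<^sub>r\<^sup>p\<^sup>,\<^sup>q\<close> is the
  quotient of \<open>Z\<^sub>r\<^sup>p\<^sup>,\<^sup>q\<close> by \<open>Z\<^sub>r\<^sub>-\<^sub>1\<^sup>p\<^sup>+\<^sup>1\<^sup>,\<^sup>q\<^sup>-\<^sup>1 + D Z\<^sub>r\<^sub>-\<^sub>1\<^sup>p\<^sup>-\<^sup>r\<^sup>+\<^sup>1\<^sup>,\<^sup>q\<^sup>+\<^sup>r\<^sup>-\<^sup>2\<close>, realised as a set of cosets,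
  and \<open>d\<^sub>r\<close> sends the class of \<open>x\<close> to the class of \<open>D x\<close>.
\<close>

context
  fixes F :: "int \<Rightarrow> int \<Rightarrow> 'a::ab_group_add set" and D :: "'a \<Rightarrow> 'a"
begin

definition ss_Z :: "int \<Rightarrow> int \<Rightarrow> int \<Rightarrow> 'a set" where
  "ss_Z r p q = {x \<in> F p (p + q). D x \<in> F (p + r) (p + q + 1)}"

definition ss_B :: "int \<Rightarrow> int \<Rightarrow> int \<Rightarrow> 'a set" where
  "ss_B r p q = {a + D b | a b. a \<in> ss_Z (r - 1) (p + 1) (q - 1) \<and>
                                b \<in> ss_Z (r - 1) (p - r + 1) (q + r - 2)}"

definition ss_class :: "int \<Rightarrow> int \<Rightarrow> int \<Rightarrow> 'a \<Rightarrow> 'a set" where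
  "ss_class r p q x = {x + b | b. b \<in> ss_B r p q}"

definition ss_E :: "int \<Rightarrow> int \<Rightarrow> int \<Rightarrow> 'a set set" where
  "ss_E r p q = ss_class r p q ` ss_Z r p q"

definition ss_d :: "int \<Rightarrow> int \<Rightarrow> int \<Rightarrow> 'a set \<Rightarrow> 'a set" where
  "ss_d r p q C = (\<Union>x\<in>C. ss_class r (p + r) (q - r + 1) (D x))"

definition ss_degenerates_at :: "int \<Rightarrow> bool" where
  "ss_degenerates_at s \<longleftrightarrow>
     (\<forall>r\<ge>s. \<forall>p q. \<forall>C\<in>ss_E r p q. ss_d r p q C = ss_class r (p + r) (q - r + 1) 0)"

end

text \<open>The filtration \<open>F\<^sup>p K\<^sup>n = \<Oplus>p' \<ge> p. A\<^sup>p\<^sup>'\<^sup>,\<^sup>n\<^sup>-\<^sup>p\<^sup>'\<close>.\<close>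

definition Kfilt :: "real lie set \<Rightarrow> int \<Rightarrow> int \<Rightarrow> kfield set" where
  "Kfilt \<Gamma> p n = {(\<Sum>k | p \<le> int k \<and> int k \<le> n. \<beta> k) | \<beta>.
     \<forall>k. p \<le> int k \<and> int k \<le> n \<longrightarrow> \<beta> k \<in> Apq \<Gamma> k (nat (n - int k))}"

definition poisson_degenerates_at :: "real lie set \<Rightarrow> kfield \<Rightarrow> int \<Rightarrow> bool" where
  "poisson_degenerates_at \<Gamma> \<Lambda> s \<longleftrightarrow>
     ss_degenerates_at (Kfilt \<Gamma>) (\<lambda>\<alpha>. schouten \<Lambda> \<alpha> + dbar \<alpha>) s"

definition Pi_biv :: kfield where
  "Pi_biv = smul 2 (gen 1 \<and>\<^sub>K gen 4) - gen 2 \<and>\<^sub>K gen 3"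

end

theory Submission
  imports Defs
begin

text \<open>
  Write \<open>g\<^sub>a\<close> for the \<open>a\<close>-th generator, so that \<open>g\<^sub>1, \<dots>, g\<^sub>4\<close> are the \<open>v\<^sub>j\<close> and \<open>g\<^sub>5, \<dots>, g\<^sub>8\<close> the
  conjugate dual forms.  On left-invariant elements \<open>\<partial>\<close>-bar is \<open>g\<^sub>5 \<and> N\<close>, where the derivation \<open>N\<close> has
  \<open>g\<^sub>1 \<mapsto> g\<^sub>2/2\<close>, \<open>g\<^sub>2 \<mapsto> g\<^sub>3\<close>, \<open>g\<^sub>3 \<mapsto> g\<^sub>4\<close>, and \<open>ad\<^sub>\<Pi>\<close> is \<open>g\<^sub>4 \<and> L\<close>, where the derivation \<open>L\<close> has
  \<open>g\<^sub>6 \<mapsto> g\<^sub>5\<close>, \<open>g\<^sub>7 \<mapsto> 2 g\<^sub>6\<close>, \<open>g\<^sub>8 \<mapsto> 2 g\<^sub>7\<close>; both kill the other generators.  So \<open>x = g\<^sub>6 \<and> g\<^sub>7\<close> is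
  \<open>\<partial>\<close>-bar closed, \<open>ad\<^sub>\<Pi> x = g\<^sub>4 \<and> g\<^sub>5 \<and> g\<^sub>7\<close> is minus the \<open>\<partial>\<close>-bar of \<open>y = g\<^sub>3 \<and> g\<^sub>7\<close>, and \<open>d\<^sub>2\<close> sends the
  class of \<open>x\<close> to that of \<open>ad\<^sub>\<Pi> y = - 2 g\<^sub>3 \<and> g\<^sub>4 \<and> g\<^sub>6\<close> (\<open>total_diff_zigzag\<close>).

  It remains to see that this class is not zero.  Otherwise \<open>- 2 g\<^sub>3 \<and> g\<^sub>4 \<and> g\<^sub>6\<close> would be, modulo
  \<open>F\<^sup>3\<close>, the differential of some \<open>b\<close> in \<open>F\<^sup>1 K\<^sup>2\<close> whose differential lies in \<open>F\<^sup>2\<close>.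
  Modulo derivatives of coefficient functions along left-invariant fields, the coefficient of
  \<open>g\<^sub>3 \<and> g\<^sub>4 \<and> g\<^sub>6\<close> in the differential of \<open>b\<close> is \<open>- 2 b\<^sub>3\<^sub>7\<close>, and that of \<open>g\<^sub>4 \<and> g\<^sub>5 \<and> g\<^sub>7\<close>, which vanishes, is
  \<open>- b\<^sub>3\<^sub>7\<close> (\<open>total_diff_coefficients\<close>).  Hence a nonzero constant would be a combination of
  derivatives, along left-invariant fields, of smooth functions on the compact nilmanifold.

  Integration over the nilmanifold would exclude this.  Here finite averages over right translations
  take the place of the integral.  A function is called mean-null if it can
  be averaged to something uniformly small, even after any prior averaging; this makes the mean-null
  functions a vector space, closed under uniform limits, which contains no nonzero constant.
  For bounded \<open>f\<close> on a nilpotent group all differences \<open>f - f (\<sqdot> h)\<close> are mean-null, by induction along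
  the central series (\<open>mean_null_difference\<close>), and derivatives along left-invariant fields are uniform limits
  of difference quotients by compactness (\<open>mean_null_lderiv\<close>).
\<close>

section \<open>Averages over right translations\<close>

context group
begin

definition tavg :: "'a list \<Rightarrow> ('a \<Rightarrow> 'b) \<Rightarrow> 'a \<Rightarrow> 'b::real_normed_field" where
  "tavg xs \<phi> g = (\<Sum>x\<leftarrow>xs. \<phi> (g \<^bold>* x)) / of_nat (length xs)"

text \<open>
  The quantifier over a prior average \<open>xs\<close> is what makes sums of such functions mean-null again: it
  allows the average that serves one summand to be composed with the one that serves the other.
\<close>

definition mean_null :: "('a \<Rightarrow> 'b::real_normed_field) \<Rightarrow> bool" where
  "mean_null \<phi> \<longleftrightarrow>
     (\<forall>xs e. xs \<noteq> [] \<longrightarrow> e > 0 \<longrightarrow> (\<exists>ys. ys \<noteq> [] \<and> (\<forall>g. norm (tavg ys (tavg xs \<phi>) g) \<le> e)))"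

lemma mean_nullE:
  assumes "mean_null \<phi>" "xs \<noteq> []" "e > 0"
  obtains ys where "ys \<noteq> []" "\<And>g. norm (tavg ys (tavg xs \<phi>) g) \<le> e"
  using assms unfolding mean_null_def by blast

lemma tavg_add: "tavg xs (\<lambda>g. \<phi> g + \<psi> g) g = tavg xs \<phi> g + tavg xs \<psi> g"
  by (simp add: tavg_def sum_list_addf add_divide_distrib)

lemma tavg_diff: "tavg xs (\<lambda>g. \<phi> g - \<psi> g) g = tavg xs \<phi> g - tavg xs \<psi> g"
  by (simp add: tavg_def sum_list_subtractf diff_divide_distrib)

lemma tavg_mult: "tavg xs (\<lambda>g. c * \<phi> g) g = c * tavg xs \<phi> g"
  by (simp add: tavg_def sum_list_const_mult)

lemma tavg_const: "xs \<noteq> [] \<Longrightarrow> tavg xs (\<lambda>g. c) = (\<lambda>g. c)"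
  by (simp add: tavg_def fun_eq_iff sum_list_triv)

lemma norm_tavg_le:
  assumes "xs \<noteq> []" "\<And>g. norm (\<phi> g) \<le> e"
  shows "norm (tavg xs \<phi> g) \<le> e"
proof -
  have "norm (\<Sum>x\<leftarrow>xs. \<phi> (g \<^bold>* x)) \<le> (\<Sum>x\<leftarrow>xs. norm (\<phi> (g \<^bold>* x)))"
    by (induction xs) (auto intro: norm_triangle_le)
  also have "\<dots> \<le> (\<Sum>x\<leftarrow>xs. e)"
    by (intro sum_list_mono assms)
  finally show ?thesis
    using assms(1) by (simp add: tavg_def norm_divide field_simps sum_list_triv)
qed

text \<open>
  Averages compose to averages, so successive averaging never leaves the class.
\<close>

lemma tavg_tavg: "tavg ys (tavg xs \<phi>) = tavg (concat (map (\<lambda>y. map (\<lambda>x. y \<^bold>* x) xs) ys)) \<phi>"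
proof -
  have len: "length (concat (map (\<lambda>y. map (\<lambda>x. y \<^bold>* x) xs) ys)) = length ys * length xs"
    by (induction ys) auto
  have sum: "(\<Sum>y\<leftarrow>ys. tavg xs \<phi> (g \<^bold>* y)) =
      (\<Sum>x\<leftarrow>concat (map (\<lambda>y. map (\<lambda>x. y \<^bold>* x) xs) ys). \<phi> (g \<^bold>* x)) / of_nat (length xs)" for g
    by (induction ys) (simp_all add: tavg_def add_divide_distrib comp_def assoc)
  show ?thesis
    unfolding tavg_def[of ys] fun_eq_iff sum by (simp add: tavg_def len mult.commute)
qed

lemma mean_null_tavg:
  assumes "mean_null \<phi>" "zs \<noteq> []"
  shows "mean_null (tavg zs \<phi>)"
  unfolding mean_null_def
proof (intro allI impI)
  fix xs :: "'a list" and e :: real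
  assume "xs \<noteq> []" "e > 0"
  moreover from this assms(2) have "concat (map (\<lambda>y. map (\<lambda>x. y \<^bold>* x) zs) xs) \<noteq> []"
    by auto
  ultimately show "\<exists>ys. ys \<noteq> [] \<and> (\<forall>g. norm (tavg ys (tavg xs (tavg zs \<phi>)) g) \<le> e)"
    using assms(1) unfolding tavg_tavg[of xs zs] mean_null_def by blast
qed

lemma mean_null_add:
  assumes "mean_null \<phi>" "mean_null \<psi>"
  shows "mean_null (\<lambda>g. \<phi> g + \<psi> g)"
  unfolding mean_null_def
proof (intro allI impI)
  fix xs :: "'a list" and e :: real
  assume xs: "xs \<noteq> []" and e: "e > 0"
  obtain ys where ys: "ys \<noteq> []" "\<And>g. norm (tavg ys (tavg xs \<phi>) g) \<le> e / 2"
    using mean_nullE[OF assms(1) xs, of "e / 2"] e by auto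
  have "mean_null (tavg xs \<psi>)"
    using assms(2) xs by (rule mean_null_tavg)
  then obtain zs where zs: "zs \<noteq> []" "\<And>g. norm (tavg zs (tavg ys (tavg xs \<psi>)) g) \<le> e / 2"
    using mean_nullE[OF _ ys(1), of "tavg xs \<psi>" "e / 2"] e by auto
  have "norm (tavg zs (tavg ys (tavg xs (\<lambda>g. \<phi> g + \<psi> g))) g) \<le> e" for g
  proof -
    have "tavg zs (tavg ys (tavg xs (\<lambda>g. \<phi> g + \<psi> g))) g
        = tavg zs (tavg ys (tavg xs \<phi>)) g + tavg zs (tavg ys (tavg xs \<psi>)) g"
      by (simp add: tavg_add[abs_def])
    moreover have "norm (tavg zs (tavg ys (tavg xs \<phi>)) g) \<le> e / 2"
      by (rule norm_tavg_le[OF zs(1) ys(2)])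
    ultimately show ?thesis
      using norm_triangle_mono[OF _ zs(2)[of g]] by fastforce
  qed
  then show "\<exists>us. us \<noteq> [] \<and> (\<forall>g. norm (tavg us (tavg xs (\<lambda>g. \<phi> g + \<psi> g)) g) \<le> e)"
    using ys(1) zs(1)
    by (intro exI[of _ "concat (map (\<lambda>y. map (\<lambda>x. y \<^bold>* x) ys) zs)"]) (auto simp: tavg_tavg[of zs ys])
qed

lemma mean_null_0: "mean_null (\<lambda>g. 0)"
  unfolding mean_null_def by (auto simp: tavg_def intro!: exI[of _ "[\<^bold>1]"])

lemma mean_null_mult:
  assumes "mean_null \<phi>"
  shows "mean_null (\<lambda>g. c * \<phi> g)"
proof (cases "c = 0")
  case False
  show ?thesis
    unfolding mean_null_def
  proof (intro allI impI)
    fix xs :: "'a list" and e :: real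
    assume "xs \<noteq> []" "e > 0"
    then obtain ys where "ys \<noteq> []" "\<And>g. norm (tavg ys (tavg xs \<phi>) g) \<le> e / norm c"
      using mean_nullE[OF assms, of xs "e / norm c"] False by auto
    then show "\<exists>ys. ys \<noteq> [] \<and> (\<forall>g. norm (tavg ys (tavg xs (\<lambda>g. c * \<phi> g)) g) \<le> e)"
      using False
      by (intro exI[of _ ys]) (auto simp: tavg_mult[abs_def] norm_mult field_simps)
  qed
qed (simp add: mean_null_0)

lemma mean_null_sum:
  assumes "\<And>i. i \<in> I \<Longrightarrow> mean_null (\<phi> i)"
  shows "mean_null (\<lambda>g. \<Sum>i\<in>I. \<phi> i g)"
  using assms by (induction I rule: infinite_finite_induct) (auto intro: mean_null_add mean_null_0)

lemma mean_null_sum_list: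
  assumes "\<And>x. x \<in> set xs \<Longrightarrow> mean_null (\<phi> x)"
  shows "mean_null (\<lambda>g. \<Sum>x\<leftarrow>xs. \<phi> x g)"
  using assms by (induction xs) (auto intro: mean_null_add mean_null_0)

text \<open>
  An average moves values by no more than the uniform distance of the two functions.
\<close>

lemma mean_null_uniform_limit:
  assumes "\<And>e. e > 0 \<Longrightarrow> \<exists>\<psi>. mean_null \<psi> \<and> (\<forall>g. norm (\<phi> g - \<psi> g) \<le> e)"
  shows "mean_null \<phi>"
  unfolding mean_null_def
proof (intro allI impI)
  fix xs :: "'a list" and e :: real
  assume xs: "xs \<noteq> []" and e: "e > 0"
  obtain \<psi> where \<psi>: "mean_null \<psi>" "\<And>g. norm (\<phi> g - \<psi> g) \<le> e / 2"
    using assms[of "e / 2"] e by auto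
  obtain ys where ys: "ys \<noteq> []" "\<And>g. norm (tavg ys (tavg xs \<psi>) g) \<le> e / 2"
    using mean_nullE[OF \<psi>(1) xs, of "e / 2"] e by auto
  have "norm (tavg ys (tavg xs \<phi>) g) \<le> e" for g
  proof -
    have "tavg ys (tavg xs \<phi>) g
        = tavg ys (tavg xs (\<lambda>g. \<phi> g - \<psi> g)) g + tavg ys (tavg xs \<psi>) g"
      by (simp add: tavg_diff[abs_def])
    moreover have "norm (tavg ys (tavg xs (\<lambda>g. \<phi> g - \<psi> g)) g) \<le> e / 2"
      using xs ys(1) \<psi>(2) by (intro norm_tavg_le)
    ultimately show ?thesis
      using norm_triangle_mono[OF _ ys(2)[of g]] by fastforce
  qed
  with ys(1) show "\<exists>ys. ys \<noteq> [] \<and> (\<forall>g. norm (tavg ys (tavg xs \<phi>) g) \<le> e)"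
    by blast
qed

lemma mean_null_const:
  assumes "mean_null (\<lambda>g. c)"
  shows "c = 0"
proof (rule ccontr)
  assume "c \<noteq> 0"
  then obtain ys where "ys \<noteq> []" "\<And>g. norm (tavg ys (tavg [\<^bold>1] (\<lambda>g. c)) g) \<le> norm c / 2"
    using mean_nullE[OF assms, of "[\<^bold>1]" "norm c / 2"] by auto
  with \<open>c \<noteq> 0\<close> show False
    by (simp add: tavg_const)
qed

text \<open>
  The average over the powers \<open>1, h, \<dots>, h\<^sup>N\<^sup>-\<^sup>1\<close> telescopes to \<open>(\<psi> - \<psi> (\<sqdot> h\<^sup>N)) / N\<close>.
\<close>

lemma tavg_powers_difference:
  fixes \<psi> :: "'a \<Rightarrow> 'b::real_normed_field"
  assumes "\<And>g. norm (\<psi> g) \<le> C" "e > 0"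
  shows "\<exists>ys. ys \<noteq> [] \<and> (\<forall>g. norm (tavg ys (\<lambda>g. \<psi> g - \<psi> (g \<^bold>* h)) g) \<le> e)"
proof -
  define pow where "pow i = ((\<lambda>x. x \<^bold>* h) ^^ i) \<^bold>1" for i
  obtain N :: nat where N: "2 * C / e < real N" "N > 0"
    using reals_Archimedean2[of "max 0 (2 * C / e)"] by (metis max_less_iff_conj of_nat_0_less_iff)
  have "norm (tavg (map pow [0..<N]) (\<lambda>g. \<psi> g - \<psi> (g \<^bold>* h)) g) \<le> e" for g
  proof -
    have pow_Suc: "g \<^bold>* pow i \<^bold>* h = g \<^bold>* pow (Suc i)" for i
      by (simp add: pow_def assoc)
    have "(\<Sum>x\<leftarrow>map pow [0..<N]. \<psi> (g \<^bold>* x) - \<psi> (g \<^bold>* x \<^bold>* h))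
        = (\<Sum>i<N. \<psi> (g \<^bold>* pow i) - \<psi> (g \<^bold>* pow (Suc i)))"
      by (simp add: comp_def interv_sum_list_conv_sum_set_nat atLeast0LessThan pow_Suc)
    also have "\<dots> = \<psi> (g \<^bold>* pow 0) - \<psi> (g \<^bold>* pow N)"
      by (rule sum_lessThan_telescope')
    finally have "tavg (map pow [0..<N]) (\<lambda>g. \<psi> g - \<psi> (g \<^bold>* h)) g
        = (\<psi> (g \<^bold>* pow 0) - \<psi> (g \<^bold>* pow N)) / of_nat N"
      by (simp add: tavg_def)
    moreover have "norm (\<psi> (g \<^bold>* pow 0) - \<psi> (g \<^bold>* pow N)) \<le> 2 * C"
      using norm_triangle_ineq4[of "\<psi> (g \<^bold>* pow 0)" "\<psi> (g \<^bold>* pow N)"]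
        assms(1)[of "g \<^bold>* pow 0"] assms(1)[of "g \<^bold>* pow N"] by linarith
    ultimately have "norm (tavg (map pow [0..<N]) (\<lambda>g. \<psi> g - \<psi> (g \<^bold>* h)) g) \<le> 2 * C / N"
      using N by (simp add: norm_divide divide_right_mono)
    also have "\<dots> \<le> e"
      using N assms(2) by (simp add: field_simps)
    finally show ?thesis .
  qed
  with N show ?thesis
    by (intro exI[of _ "map pow [0..<N]"]) auto
qed

text \<open>
  The step of an induction along a central series, from the commutators with \<open>h\<close> to \<open>h\<close> itself.
  If \<open>h\<close> commutes with everything, a prior average passes through the difference, and the average
  over powers of \<open>h\<close> makes the result small.  In general, moving \<open>h\<close> past \<open>a\<close> costs a commutator
  \<open>c\<close>; the resulting error is an average of translates of \<open>\<phi> - \<phi> (\<sqdot> c)\<close>, which are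
  mean-null, so that a further average disposes of it.
\<close>

lemma mean_null_difference_step:
  fixes \<phi> :: "'a \<Rightarrow> 'b::real_normed_field"
  assumes \<phi>: "\<And>g. norm (\<phi> g) \<le> C"
    and K: "\<And>c. c \<in> K \<Longrightarrow> mean_null (\<lambda>g. \<phi> g - \<phi> (g \<^bold>* c))"
    and h: "\<And>a. \<exists>c\<in>K. a \<^bold>* h = h \<^bold>* a \<^bold>* c"
  shows "mean_null (\<lambda>g. \<phi> g - \<phi> (g \<^bold>* h))"
  unfolding mean_null_def
proof (intro allI impI)
  fix xs :: "'a list" and e :: real
  assume xs: "xs \<noteq> []" and e: "e > 0"
  obtain c where c: "\<And>a. c a \<in> K" "\<And>a. a \<^bold>* h = h \<^bold>* a \<^bold>* c a"
    using h by metis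
  define \<sigma> where
    "\<sigma> g = (1 / of_nat (length xs)) * (\<Sum>a\<leftarrow>xs. tavg [h \<^bold>* a] (\<lambda>g. \<phi> g - \<phi> (g \<^bold>* c a)) g)" for g
  have \<sigma>: "mean_null \<sigma>"
    unfolding \<sigma>_def[abs_def]
    by (intro mean_null_mult mean_null_sum_list mean_null_tavg K c) simp
  have split: "tavg xs (\<lambda>g. \<phi> g - \<phi> (g \<^bold>* h)) = (\<lambda>g. (tavg xs \<phi> g - tavg xs \<phi> (g \<^bold>* h)) + \<sigma> g)"
  proof
    fix g
    have "(\<Sum>a\<leftarrow>xs. \<phi> (g \<^bold>* a) - \<phi> (g \<^bold>* a \<^bold>* h))
        = (\<Sum>a\<leftarrow>xs. \<phi> (g \<^bold>* a)) - (\<Sum>a\<leftarrow>xs. \<phi> (g \<^bold>* h \<^bold>* a))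
          + (\<Sum>a\<leftarrow>xs. tavg [h \<^bold>* a] (\<lambda>g. \<phi> g - \<phi> (g \<^bold>* c a)) g)"
    proof (induction xs)
      case (Cons a xs)
      have "g \<^bold>* a \<^bold>* h = g \<^bold>* h \<^bold>* a \<^bold>* c a"
        using c(2)[of a] by (simp add: assoc)
      with Cons show ?case
        by (simp add: tavg_def assoc)
    qed simp
    then show "tavg xs (\<lambda>g. \<phi> g - \<phi> (g \<^bold>* h)) g = (tavg xs \<phi> g - tavg xs \<phi> (g \<^bold>* h)) + \<sigma> g"
      by (simp add: tavg_def \<sigma>_def add_divide_distrib diff_divide_distrib)
  qed
  obtain ys where ys: "ys \<noteq> []"
      "\<And>g. norm (tavg ys (\<lambda>g. tavg xs \<phi> g - tavg xs \<phi> (g \<^bold>* h)) g) \<le> e / 2"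
    using tavg_powers_difference[of "tavg xs \<phi>" C "e / 2" h] norm_tavg_le[OF xs \<phi>] e by auto
  obtain zs where zs: "zs \<noteq> []" "\<And>g. norm (tavg zs (tavg ys \<sigma>) g) \<le> e / 2"
    using mean_nullE[OF \<sigma> ys(1), of "e / 2"] e by auto
  have "norm (tavg zs (tavg ys (tavg xs (\<lambda>g. \<phi> g - \<phi> (g \<^bold>* h)))) g) \<le> e" for g
  proof -
    have "tavg zs (tavg ys (tavg xs (\<lambda>g. \<phi> g - \<phi> (g \<^bold>* h)))) g
        = tavg zs (tavg ys (\<lambda>g. tavg xs \<phi> g - tavg xs \<phi> (g \<^bold>* h))) g + tavg zs (tavg ys \<sigma>) g"
      by (simp add: split tavg_add[abs_def])
    moreover have "norm (tavg zs (tavg ys (\<lambda>g. tavg xs \<phi> g - tavg xs \<phi> (g \<^bold>* h))) g) \<le> e / 2"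
      by (rule norm_tavg_le[OF zs(1) ys(2)])
    ultimately show ?thesis
      using norm_triangle_mono[OF _ zs(2)[of g]] by fastforce
  qed
  then show "\<exists>us. us \<noteq> [] \<and> (\<forall>g. norm (tavg us (tavg xs (\<lambda>g. \<phi> g - \<phi> (g \<^bold>* h))) g) \<le> e)"
    using ys(1) zs(1)
    by (intro exI[of _ "concat (map (\<lambda>y. map (\<lambda>x. y \<^bold>* x) ys) zs)"]) (auto simp: tavg_tavg[of zs ys])
qed

end

section \<open>Left-invariant derivatives have mean zero\<close>

interpretation bch: group bch 0 uminus
  by standard (simp_all add: bch_assoc)

lemma bch_commutator:
  fixes a h :: "real lie"
  defines "c \<equiv> bch (- a) (bch (- h) (bch a h))"
  shows "bch a h = bch (bch h a) c"
proof -
  have "bch x (bch (- x) y) = y" for x y :: "real lie"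
    by (simp flip: bch_assoc)
  then show ?thesis
    by (simp add: c_def bch_assoc)
qed

text \<open>
  The vanishing of the first coordinates defines the terms of a central series: a commutator with an
  arbitrary element lies one term further down.
\<close>

lemma bch_commutator_descends:
  fixes a h :: "real lie"
  defines "c \<equiv> bch (- a) (bch (- h) (bch a h))"
  shows "fst c $ 1 = 0 \<and> snd c $ 1 = 0"
    and "fst h $ 1 = 0 \<and> snd h $ 1 = 0 \<Longrightarrow> fst c $ 2 = 0 \<and> snd c $ 2 = 0"
    and "fst h $ 1 = 0 \<and> snd h $ 1 = 0 \<Longrightarrow> fst h $ 2 = 0 \<and> snd h $ 2 = 0 \<Longrightarrow>
      fst c $ 3 = 0 \<and> snd c $ 3 = 0"
  by (simp_all add: c_def bch_def)

lemma bch_central: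
  fixes a h :: "real lie"
  assumes "fst h $ 1 = 0 \<and> snd h $ 1 = 0" "fst h $ 2 = 0 \<and> snd h $ 2 = 0" "fst h $ 3 = 0 \<and> snd h $ 3 = 0"
  shows "bch a h = bch h a"
  using assms by (intro lie_eqI) (simp_all add: bch_def)

lemma mean_null_difference:
  fixes f :: "real lie \<Rightarrow> complex"
  assumes f: "\<And>g. norm (f g) \<le> C"
  shows "bch.mean_null (\<lambda>g. f g - f (bch g h))"
proof -
  let ?null = "\<lambda>h. bch.mean_null (\<lambda>g. f g - f (bch g h))"
  let ?Z = "\<lambda>i h. fst h $ i = 0 \<and> snd h $ i = 0"
  have step: "?null h" if "\<And>a. ?null (bch (- a) (bch (- h) (bch a h)))" for h
  proof (rule bch.mean_null_difference_step[OF f, of "range (\<lambda>a. bch (- a) (bch (- h) (bch a h)))"])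
    show "\<exists>c\<in>range (\<lambda>a. bch (- a) (bch (- h) (bch a h))). bch a h = bch (bch h a) c" for a
      by (intro bexI[where x = "bch (- a) (bch (- h) (bch a h))"] bch_commutator) simp
    show "?null c" if "c \<in> range (\<lambda>a. bch (- a) (bch (- h) (bch a h)))" for c
      using that \<open>\<And>a. ?null (bch (- a) (bch (- h) (bch a h)))\<close> by (elim rangeE) simp
  qed
  \<comment> \<open>The proper terms of the central series, from the centre upwards.\<close>
  have 1: "?null h" if "?Z 1 h" "?Z 2 h" "?Z 3 h" for h
  proof (rule bch.mean_null_difference_step[OF f, of "{0}"])
    show "\<exists>c\<in>{0}. bch a h = bch (bch h a) c" for a
      using bch_central[OF that] by simp
  qed (simp add: bch.mean_null_0)
  have 2: "?null h" if "?Z 1 h" "?Z 2 h" for h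
    by (rule step, rule 1; (rule bch_commutator_descends that)+)
  have 3: "?null h" if "?Z 1 h" for h
    by (rule step, rule 2; (rule bch_commutator_descends that)+)
  show ?thesis
    by (rule step, rule 3, rule bch_commutator_descends)
qed

lemma bch_line: "bch (s *\<^sub>R u) (t *\<^sub>R u) = (s + t) *\<^sub>R u"
  by (rule lie_eqI; simp add: bch_def algebra_simps)

lemma continuous_on_bch [continuous_intros]:
  assumes "continuous_on S f" "continuous_on S g"
  shows "continuous_on S (\<lambda>x. bch (f x) (g x))"
proof -
  note [continuous_intros] = bounded_bilinear.continuous_on[OF lie_br_bounded_bilinear]
  show ?thesis
    unfolding bch_def by (intro continuous_intros assms)
qed

lemma continuous_on_linv [continuous_intros]:
  assumes "continuous_on S f"
  shows "continuous_on S (\<lambda>x. linv u (f x))"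
proof -
  note [continuous_intros] = bounded_bilinear.continuous_on[OF lie_br_bounded_bilinear]
  show ?thesis
    unfolding linv_def by (intro continuous_intros assms)
qed

lemma smooth_funD:
  assumes "smooth_fun \<Gamma> f"
  shows "continuous_on UNIV f" "f differentiable at g"
    "continuous_on UNIV (\<lambda>g. frechet_derivative f (at g) u)"
    "\<gamma> \<in> \<Gamma> \<Longrightarrow> f (bch \<gamma> g) = f g"
proof -
  have "Ck 0 f" "Ck (Suc 0) f"
    using assms unfolding smooth_fun_def by blast+
  then show "continuous_on UNIV f" "f differentiable at g"
    "continuous_on UNIV (\<lambda>g. frechet_derivative f (at g) u)"
    by (simp_all del: split_paired_All)
  show "\<gamma> \<in> \<Gamma> \<Longrightarrow> f (bch \<gamma> g) = f g"
    using assms unfolding smooth_fun_def by blast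
qed

lemma lderiv_eq_frechet:
  assumes "f differentiable at g"
  shows "((\<lambda>t. f (bch g (t *\<^sub>R u))) has_vector_derivative frechet_derivative f (at g) (linv u g)) (at 0)"
    and "lderiv u f g = frechet_derivative f (at g) (linv u g)"
proof -
  have "(f has_derivative frechet_derivative f (at g)) (at (bch g (0 *\<^sub>R u)) within range (\<lambda>t. bch g (t *\<^sub>R u)))"
    using assms by (simp add: frechet_derivative_works has_derivative_at_withinI)
  from vector_derivative_diff_chain_within[OF bch_has_vector_derivative this]
  show 1: "((\<lambda>t. f (bch g (t *\<^sub>R u))) has_vector_derivative frechet_derivative f (at g) (linv u g)) (at 0)"
    by (simp add: comp_def)
  then show "lderiv u f g = frechet_derivative f (at g) (linv u g)"
    unfolding lderiv_def by (rule vector_derivative_at)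
qed

text \<open>
  The derivative is linear in its direction \<open>linv u g\<close>, so expanding that vector in a basis separates
  the two ways in which \<open>g\<close> enters.
\<close>

lemma continuous_on_lderiv:
  assumes "smooth_fun \<Gamma> f"
  shows "continuous_on UNIV (lderiv u f)"
proof -
  have "lderiv u f = (\<lambda>g. \<Sum>b\<in>Basis. (linv u g \<bullet> b) *\<^sub>R frechet_derivative f (at g) b)"
  proof
    fix g
    have f: "f differentiable at g"
      using assms by (rule smooth_funD)
    then interpret linear "frechet_derivative f (at g)"
      by (rule linear_frechet_derivative)
    have "frechet_derivative f (at g) (linv u g)
        = frechet_derivative f (at g) (\<Sum>b\<in>Basis. (linv u g \<bullet> b) *\<^sub>R b)"
      by (simp only: euclidean_representation)
    then show "lderiv u f g = (\<Sum>b\<in>Basis. (linv u g \<bullet> b) *\<^sub>R frechet_derivative f (at g) b)"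
      by (simp add: lderiv_eq_frechet(2)[OF f] sum scale del: euclidean_representation)
  qed
  then show ?thesis
    using smooth_funD(3)[OF assms] by (auto intro!: continuous_intros)
qed

lemma lderiv_invariant:
  assumes "smooth_fun \<Gamma> f" "\<gamma> \<in> \<Gamma>"
  shows "lderiv u f (bch \<gamma> g) = lderiv u f g"
  by (simp add: lderiv_def bch_assoc smooth_funD(4)[OF assms])

text \<open>
  The curve \<open>t \<mapsto> t u\<close> is a one-parameter subgroup, so the derivative at time \<open>s\<close> is the derivative at
  time \<open>0\<close> from the base point translated by \<open>s u\<close>.
\<close>

lemma lderiv_along_line:
  assumes "smooth_fun \<Gamma> f"
  shows "((\<lambda>t. f (bch g (t *\<^sub>R u))) has_vector_derivative lderiv u f (bch g (s *\<^sub>R u))) (at s)"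
proof -
  let ?g = "bch g (s *\<^sub>R u)"
  have f: "f differentiable at ?g"
    using assms by (rule smooth_funD)
  have "((\<lambda>t. f (bch ?g (t *\<^sub>R u))) has_vector_derivative lderiv u f ?g) (at (s - s))"
    using lderiv_eq_frechet[OF f] by simp
  moreover have "((\<lambda>t. t - s) has_vector_derivative 1) (at s)"
    by (auto intro!: derivative_eq_intros)
  ultimately have "((\<lambda>t. f (bch ?g (t *\<^sub>R u))) \<circ> (\<lambda>t. t - s) has_vector_derivative 1 *\<^sub>R lderiv u f ?g) (at s)"
    by (intro vector_diff_chain_at)
  then show ?thesis
    by (simp add: comp_def bch_assoc bch_line)
qed

text \<open>
  Everything is invariant under the lattice, so only base points in a compact set \<open>K\<close> matter, and
  there the derivative along the curve is uniformly continuous.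
\<close>

lemma lderiv_uniform_approx:
  assumes \<Gamma>: "cocompact_lattice \<Gamma>" and f: "smooth_fun \<Gamma> f" and e: "e > 0"
  shows "\<exists>t>0. \<forall>g. norm (lderiv u f g - (f (bch g (t *\<^sub>R u)) - f g) / of_real t) \<le> e"
proof -
  obtain K where K: "compact K" and cover: "\<And>g. \<exists>\<gamma>\<in>\<Gamma>. \<exists>k\<in>K. g = bch \<gamma> k"
    using \<Gamma> unfolding cocompact_lattice_def by blast
  have "continuous_on (K \<times> {0..1}) (\<lambda>(k, s). lderiv u f (bch k (s *\<^sub>R u)))"
    unfolding case_prod_unfold
    by (intro continuous_on_compose2[OF continuous_on_lderiv[OF f]] continuous_intros) auto
  then have "uniformly_continuous_on (K \<times> {0..1}) (\<lambda>(k, s). lderiv u f (bch k (s *\<^sub>R u)))"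
    using K by (intro compact_uniformly_continuous compact_Times) auto
  then obtain d where d: "d > 0" and
    dist: "\<And>p q. p \<in> K \<times> {0..1} \<Longrightarrow> q \<in> K \<times> {0..1} \<Longrightarrow> dist p q < d \<Longrightarrow>
       dist ((\<lambda>(k, s). lderiv u f (bch k (s *\<^sub>R u))) p) ((\<lambda>(k, s). lderiv u f (bch k (s *\<^sub>R u))) q) < e"
    using e unfolding uniformly_continuous_on_def by metis
  define t where "t = min 1 (d / 2)"
  have t: "0 < t" "t \<le> 1" "t < d"
    using d by (auto simp: t_def)
  have near: "norm (lderiv u f (bch k (s *\<^sub>R u)) - lderiv u f k) \<le> e" if "k \<in> K" "s \<in> {0..t}" for k s
    using dist[of "(k, s)" "(k, 0)"] that t by (auto simp: dist_Pair_Pair dist_norm)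
  have "norm (lderiv u f k - (f (bch k (t *\<^sub>R u)) - f k) / of_real t) \<le> e" if k: "k \<in> K" for k
  proof -
    \<comment> \<open>Up to the factor \<open>t\<close>, the error is the increment of a function whose derivative is at most \<open>e\<close>.\<close>
    define \<phi> where "\<phi> s = f (bch k (s *\<^sub>R u)) - s *\<^sub>R lderiv u f k" for s
    have "(\<phi> has_derivative (\<lambda>h. h *\<^sub>R (lderiv u f (bch k (s *\<^sub>R u)) - lderiv u f k))) (at s within {0..t})" for s
    proof -
      have "(\<phi> has_vector_derivative lderiv u f (bch k (s *\<^sub>R u)) - lderiv u f k) (at s)"
        unfolding \<phi>_def by (auto intro!: derivative_eq_intros lderiv_along_line[OF f])
      then show ?thesis
        by (auto simp: has_vector_derivative_def intro: has_derivative_at_withinI)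
    qed
    then have "norm (\<phi> t - \<phi> 0) \<le> e * norm (t - 0)"
      using near[OF k] t
      by (intro differentiable_bound[of "{0..t}"] onorm_le) (auto simp: mult.commute[of e] intro!: mult_left_mono)
    moreover have "\<phi> t - \<phi> 0 = - of_real t * (lderiv u f k - (f (bch k (t *\<^sub>R u)) - f k) / of_real t)"
      using t by (simp add: \<phi>_def field_simps scaleR_conv_of_real)
    ultimately show ?thesis
      using t by (simp add: norm_mult mult.commute)
  qed
  then have "norm (lderiv u f g - (f (bch g (t *\<^sub>R u)) - f g) / of_real t) \<le> e" for g
    using cover[of g] by (auto simp: lderiv_invariant[OF f] bch_assoc smooth_funD(4)[OF f])
  with t show ?thesis by blast
qed

lemma smooth_fun_bounded:
  assumes \<Gamma>: "cocompact_lattice \<Gamma>" and f: "smooth_fun \<Gamma> f"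
  shows "\<exists>C. \<forall>g. norm (f g) \<le> C"
proof -
  obtain K where K: "compact K" and cover: "\<And>g. \<exists>\<gamma>\<in>\<Gamma>. \<exists>k\<in>K. g = bch \<gamma> k"
    using \<Gamma> unfolding cocompact_lattice_def by blast
  have "continuous_on K f"
    using smooth_funD(1)[OF f] by (rule continuous_on_subset) simp
  then have "bounded (f ` K)"
    using K by (intro compact_imp_bounded compact_continuous_image)
  then obtain C where C: "\<And>k. k \<in> K \<Longrightarrow> norm (f k) \<le> C"
    unfolding bounded_iff by blast
  have "norm (f g) \<le> C" for g
    using cover[of g] C by (auto simp: smooth_funD(4)[OF f])
  then show ?thesis by blast
qed

lemma mean_null_lderiv:
  assumes \<Gamma>: "cocompact_lattice \<Gamma>" and f: "smooth_fun \<Gamma> f"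
  shows "bch.mean_null (lderiv u f)"
proof (rule bch.mean_null_uniform_limit)
  fix e :: real
  assume "e > 0"
  then obtain t where t: "\<And>g. norm (lderiv u f g - (f (bch g (t *\<^sub>R u)) - f g) / of_real t) \<le> e"
    using lderiv_uniform_approx[OF assms] by blast
  obtain C where C: "\<And>g. norm (f g) \<le> C"
    using smooth_fun_bounded[OF assms] by blast
  have "bch.mean_null (\<lambda>g. (- 1 / of_real t) * (f g - f (bch g (t *\<^sub>R u))))"
    using C by (intro bch.mean_null_mult mean_null_difference)
  moreover have "(\<lambda>g. (- 1 / of_real t) * (f g - f (bch g (t *\<^sub>R u)))) =
      (\<lambda>g. (f (bch g (t *\<^sub>R u)) - f g) / of_real t)"
    by (simp only: times_divide_eq_left mult_minus1 minus_diff_eq)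
  ultimately have null: "bch.mean_null (\<lambda>g. (f (bch g (t *\<^sub>R u)) - f g) / of_real t)"
    by (simp only:)
  show "\<exists>\<psi>. bch.mean_null \<psi> \<and> (\<forall>g. norm (lderiv u f g - \<psi> g) \<le> e)"
    by (intro exI conjI allI) (rule null, rule t)
qed

text \<open>
  This takes the place of the vanishing of the integral of a derivative over the nilmanifold.
\<close>

lemma mean_null_cderiv:
  assumes "cocompact_lattice \<Gamma>" "smooth_fun \<Gamma> f"
  shows "bch.mean_null (cderiv w f)"
  unfolding cderiv_def
  by (intro bch.mean_null_sum bch.mean_null_add bch.mean_null_mult mean_null_lderiv[OF assms])

section \<open>Exterior algebra in the frame\<close>

lemma wedge_gen:
  "(gen a \<and>\<^sub>K \<alpha>) S g =
     (if finite S \<and> a \<in> S then (-1) ^ card {j\<in>S. j < a} * \<alpha> (S - {a}) g else 0)"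
proof (cases "finite S")
  case True
  have "(gen a \<and>\<^sub>K \<alpha>) S g = (\<Sum>T\<in>Pow S \<inter> {{a}}.
      (-1) ^ card {(i, j). i \<in> T \<and> j \<in> S - T \<and> j < i} * (gen a T g * \<alpha> (S - T) g))"
    unfolding wedge_def using True
    by (intro sum.mono_neutral_right) (auto simp: gen_def)
  also have "\<dots> = (if a \<in> S then (-1) ^ card {(i, j). i \<in> {a} \<and> j \<in> S - {a} \<and> j < i} * \<alpha> (S - {a}) g else 0)"
    by (auto simp: gen_def)
  also have "{(i, j). i \<in> {a} \<and> j \<in> S - {a} \<and> j < i} = Pair a ` {j\<in>S. j < a}"
    by auto
  finally show ?thesis
    using True by (simp add: card_image inj_on_def)
qed (simp add: wedge_def)

text \<open>
  The values of \<open>dbar_gen\<close> are products of two generators.  Reassociating leaves only products with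
  a single generator on the left, which \<open>wedge_gen\<close> evaluates.
\<close>

lemma wedge_gen_gen_assoc:
  assumes "b < a"
  shows "(gen a \<and>\<^sub>K gen b) \<and>\<^sub>K \<gamma> = gen a \<and>\<^sub>K (gen b \<and>\<^sub>K \<gamma>)"
proof (intro ext)
  fix S g
  have ab: "(gen a \<and>\<^sub>K gen b) T g = (if T = {a, b} then -1 else 0)" for T
  proof (cases "T = {a, b}")
    case True
    then have "{j\<in>T. j < a} = {b}" "T - {a} = {b}" "finite T" "a \<in> T"
      using assms by auto
    with True have "(gen a \<and>\<^sub>K gen b) {a, b} g = -1"
      unfolding wedge_gen by (simp add: gen_def)
    with True show ?thesis by simp
  next
    case False
    then show ?thesis
      unfolding wedge_gen using assms by (auto simp: gen_def)
  qed
  show "((gen a \<and>\<^sub>K gen b) \<and>\<^sub>K \<gamma>) S g = (gen a \<and>\<^sub>K (gen b \<and>\<^sub>K \<gamma>)) S g"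
  proof (cases "finite S \<and> {a, b} \<subseteq> S")
    case True
    have pairs: "{(i, j). i \<in> {a, b} \<and> j \<in> S - {a, b} \<and> j < i}
        = Pair a ` {j\<in>S - {a, b}. j < a} \<union> Pair b ` {j\<in>S - {a, b}. j < b}"
      by auto
    have "card (Pair a ` {j\<in>S - {a, b}. j < a} \<union> Pair b ` {j\<in>S - {a, b}. j < b})
        = card {j\<in>S - {a, b}. j < a} + card {j\<in>S - {a, b}. j < b}"
    proof -
      have "Pair a ` {j\<in>S - {a, b}. j < a} \<inter> Pair b ` {j\<in>S - {a, b}. j < b} = {}"
        using assms by blast
      moreover have "inj_on (Pair c) X" for c :: nat and X :: "nat set"
        by (simp add: inj_on_def)
      ultimately show ?thesis
        using True by (simp add: card_Un_disjoint card_image)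
    qed
    then have inversions: "card {(i, j). i \<in> {a, b} \<and> j \<in> S - {a, b} \<and> j < i}
        = card {j\<in>S - {a, b}. j < a} + card {j\<in>S - {a, b}. j < b}"
      by (simp only: pairs)
    have "((gen a \<and>\<^sub>K gen b) \<and>\<^sub>K \<gamma>) S g = (\<Sum>T\<in>{{a, b}}.
      (-1) ^ card {(i, j). i \<in> T \<and> j \<in> S - T \<and> j < i} * ((gen a \<and>\<^sub>K gen b) T g * \<gamma> (S - T) g))"
      unfolding wedge_def[of "gen a \<and>\<^sub>K gen b"]
    proof (rule sum.mono_neutral_right)
      show "finite (Pow S)" "{{a, b}} \<subseteq> Pow S"
        using True by auto
    qed (simp add: ab)
    also have "\<dots> =
      - ((-1) ^ (card {j\<in>S - {a, b}. j < a} + card {j\<in>S - {a, b}. j < b}) * \<gamma> (S - {a, b}) g)"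
      by (simp only: sum.insert sum.empty finite.emptyI empty_iff not_False_eq_True inversions ab) simp
    finally have 1: "((gen a \<and>\<^sub>K gen b) \<and>\<^sub>K \<gamma>) S g =
      - ((-1) ^ (card {j\<in>S - {a, b}. j < a} + card {j\<in>S - {a, b}. j < b}) * \<gamma> (S - {a, b}) g)" .
    have "{j\<in>S. j < a} = insert b {j\<in>S - {a, b}. j < a}"
      using True assms by auto
    then have "card {j\<in>S. j < a} = Suc (card {j\<in>S - {a, b}. j < a})"
      using True by simp
    moreover have "{j\<in>S - {a}. j < b} = {j\<in>S - {a, b}. j < b}" "S - {a} - {b} = S - {a, b}"
      using assms by auto
    ultimately show ?thesis
      using True assms by (simp add: 1 wedge_gen power_add)
  next
    case False
    have "((gen a \<and>\<^sub>K gen b) \<and>\<^sub>K \<gamma>) S g = 0"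
    proof (cases "finite S")
      case True
      with False have "T \<noteq> {a, b}" if "T \<in> Pow S" for T
        using that by blast
      then show ?thesis
        unfolding wedge_def[of "gen a \<and>\<^sub>K gen b"] by (intro sum.neutral) (simp add: ab)
    qed (simp add: wedge_def[of "gen a \<and>\<^sub>K gen b"])
    moreover have "(gen a \<and>\<^sub>K (gen b \<and>\<^sub>K \<gamma>)) S g = 0"
      using False by (auto simp: wedge_gen)
    ultimately show ?thesis by simp
  qed
qed

lemma wedge_add_right: "\<alpha> \<and>\<^sub>K (\<beta> + \<gamma>) = \<alpha> \<and>\<^sub>K \<beta> + \<alpha> \<and>\<^sub>K \<gamma>"
  by (simp add: wedge_def fun_eq_iff algebra_simps sum.distrib)

lemma wedge_smul: "smul c \<alpha> \<and>\<^sub>K \<beta> = smul c (\<alpha> \<and>\<^sub>K \<beta>)" "\<alpha> \<and>\<^sub>K smul c \<beta> = smul c (\<alpha> \<and>\<^sub>K \<beta>)"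
  by (simp_all add: wedge_def fun_eq_iff smul_def sum_distrib_left mult_ac)

lemma wedge_0: "0 \<and>\<^sub>K \<alpha> = 0" "\<alpha> \<and>\<^sub>K 0 = 0"
  by (simp_all add: wedge_def fun_eq_iff)

text \<open>
  The monomials in the generators; left-invariant elements are their linear combinations.
\<close>

definition blade :: "nat set \<Rightarrow> kfield" where
  "blade T = (\<lambda>S g. if S = T then 1 else 0)"

lemma gen_eq_blade: "gen a = blade {a}"
  by (simp add: gen_def blade_def)

text \<open>
  In this form the signs of wedge products and contractions simplify for explicit sets of numerals.
\<close>

lemma count_eq_card:
  assumes "finite T"
  shows "(\<Sum>j\<in>T. if P j then 1 else 0) = card {j\<in>T. P j}"
  unfolding card_eq_sum by (rule sum.inter_filter[OF assms, symmetric])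

lemma wedge_gen_blade:
  assumes "finite T"
  shows "blade {a} \<and>\<^sub>K blade T =
    (if a \<in> T then 0 else smul ((-1) ^ (\<Sum>j\<in>T. if j < a then 1 else 0)) (blade (insert a T)))"
proof (intro ext)
  fix S g
  have "{j\<in>insert a T. j < a} = {j\<in>T. j < a}" by auto
  moreover have "a \<in> S \<and> S - {a} = T \<longleftrightarrow> a \<notin> T \<and> S = insert a T" by blast
  ultimately show "(blade {a} \<and>\<^sub>K blade T) S g
      = (if a \<in> T then 0 else smul ((-1) ^ (\<Sum>j\<in>T. if j < a then 1 else 0)) (blade (insert a T))) S g"
    unfolding gen_eq_blade[symmetric] wedge_gen count_eq_card[OF assms] using assms
    unfolding blade_def smul_def by (cases "a \<in> S \<and> S - {a} = T") (simp_all, blast)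
qed

lemma lcontr_blade:
  assumes "finite T"
  shows "lcontr a (blade T) =
    (if a \<in> T then smul ((-1) ^ (\<Sum>j\<in>T. if j < a then 1 else 0)) (blade (T - {a})) else 0)"
proof (intro ext)
  fix S g
  have "{j\<in>T - {a}. j < a} = {j\<in>T. j < a}" by auto
  moreover have "a \<notin> S \<and> insert a S = T \<longleftrightarrow> a \<in> T \<and> S = T - {a}" by blast
  ultimately show "(lcontr a (blade T)) S g
      = (if a \<in> T then smul ((-1) ^ (\<Sum>j\<in>T. if j < a then 1 else 0)) (blade (T - {a})) else 0) S g"
    unfolding lcontr_def blade_def smul_def count_eq_card[OF assms]
    by (cases "a \<notin> S \<and> insert a S = T") (simp_all, blast)
qed

lemma rcontr_blade:
  assumes "finite T"
  shows "rcontr (blade T) a =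
    (if a \<in> T then smul ((-1) ^ (\<Sum>j\<in>T. if a < j then 1 else 0)) (blade (T - {a})) else 0)"
proof (intro ext)
  fix S g
  have "{j\<in>T - {a}. a < j} = {j\<in>T. a < j}" by auto
  moreover have "a \<notin> S \<and> insert a S = T \<longleftrightarrow> a \<in> T \<and> S = T - {a}" by blast
  ultimately show "(rcontr (blade T) a) S g
      = (if a \<in> T then smul ((-1) ^ (\<Sum>j\<in>T. if a < j then 1 else 0)) (blade (T - {a})) else 0) S g"
    unfolding rcontr_def blade_def smul_def count_eq_card[OF assms]
    by (cases "a \<notin> S \<and> insert a S = T") (simp_all, blast)
qed

lemma contr_linear:
  "lcontr a (\<alpha> + \<beta>) = lcontr a \<alpha> + lcontr a \<beta>"
  "lcontr a (smul c \<alpha>) = smul c (lcontr a \<alpha>)" "lcontr a 0 = 0"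
  "rcontr (\<alpha> + \<beta>) a = rcontr \<alpha> a + rcontr \<beta> a" "rcontr (smul c \<alpha>) a = smul c (rcontr \<alpha> a)"
  by (auto simp: lcontr_def rcontr_def smul_def fun_eq_iff algebra_simps)

lemma smul_simps:
  "smul 1 \<alpha> = \<alpha>" "smul 0 \<alpha> = 0" "smul c 0 = 0" "smul c (smul d \<alpha>) = smul (c * d) \<alpha>"
  by (simp_all add: smul_def fun_eq_iff)

lemma act_constant:
  assumes "\<And>S g h. \<alpha> S g = \<alpha> S h"
  shows "act w \<alpha> = 0"
proof -
  have "lderiv u (\<alpha> S) g = 0" for u S g
  proof -
    have "(\<lambda>t. \<alpha> S (bch g (t *\<^sub>R u))) = (\<lambda>t. \<alpha> S g)"
      by (rule ext) (rule assms)
    then show ?thesis by (simp add: lderiv_def)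
  qed
  then show ?thesis
    by (simp add: act_def cderiv_def fun_eq_iff)
qed

lemma wedge_gen_apply:
  assumes "finite S"
  shows "(gen a \<and>\<^sub>K \<alpha>) S g =
    (if a \<in> S then (-1) ^ (\<Sum>j\<in>S. if j < a then 1 else 0) * \<alpha> (S - {a}) g else 0)"
  using assms by (simp add: wedge_gen count_eq_card)

lemma lcontr_apply:
  assumes "finite S"
  shows "lcontr a \<alpha> S g =
    (if a \<in> S then 0 else (-1) ^ (\<Sum>j\<in>S. if j < a then 1 else 0) * \<alpha> (insert a S) g)"
  using assms by (simp add: lcontr_def count_eq_card)

lemma act_0: "act w 0 = 0"
  by (rule act_constant) simp

lemma cderiv_0: "cderiv w 0 g = 0"
  using fun_cong[OF fun_cong[OF act_0[of w], of "{}"], of g] by (simp add: act_def)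

section \<open>The differentials in the frame\<close>

text \<open>
  All brackets in the frame and its conjugate come from these, since the complex structure is
  abelian: \<open>\<gg>\<^sup>1\<^sup>,\<^sup>0\<close> and its conjugate are abelian subalgebras.
\<close>

lemma lie_br_vbar_vvec:
  "lie_br (vbar 1) (vvec 1) = lie_scale (1/2) (vvec 2 - vbar 2)"
  "lie_br (vbar 1) (vvec 2) = vvec 3" "lie_br (vbar 1) (vvec 3) = vvec 4" "lie_br (vbar 1) (vvec 4) = 0"
  "lie_br (vbar 2) (vvec 1) = - vbar 3" "lie_br (vbar 3) (vvec 1) = - vbar 4" "lie_br (vbar 4) (vvec 1) = 0"
  "j \<in> {2,3,4} \<Longrightarrow> k \<in> {2,3,4} \<Longrightarrow> lie_br (vbar j) (vvec k) = 0"
  by (rule lie_eqI; auto simp: vvec_def vbar_def lie_scale_def xvec_def yvec_def axis_def)+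

lemma lie_br_vvec_vvec:
  assumes "a \<in> {1..4}" "b \<in> {1..4}"
  shows "lie_br (vvec a) (vvec b) = 0"
proof -
  have "{1..4} = {1,2,3,4::nat}" by auto
  with assms show ?thesis
    by (intro lie_eqI; auto simp: vvec_def lie_scale_def xvec_def yvec_def axis_def)
qed

lemma lie_br_swap: "lie_br u w = - lie_br w (u :: 'k::comm_ring_1 lie)"
  by (rule lie_eqI) (simp_all add: algebra_simps)

lemma om_linear:
  "om k 0 = 0" "om k (- u) = - om k u" "om k (u - w) = om k u - om k w" "om k (lie_scale c u) = c * om k u"
  "ombar k 0 = 0" "ombar k (- u) = - ombar k u" "ombar k (u - w) = ombar k u - ombar k w"
  "ombar k (lie_scale c u) = c * ombar k u"
  by (simp_all add: om_def ombar_def lie_scale_def algebra_simps)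

lemma sum_1_4: "(\<Sum>j=1..4. F j) = F 1 + F 2 + F 3 + F (4::nat)" for F :: "nat \<Rightarrow> 'a::comm_monoid_add"
proof -
  have "{1..4} = {1,2,3,4::nat}" by auto
  then show ?thesis by (simp add: add.assoc)
qed

lemma sum_1_8: "(\<Sum>j=1..8. F j) = F 1 + F 2 + F 3 + F 4 + F 5 + F 6 + F 7 + F (8::nat)"
  for F :: "nat \<Rightarrow> 'a::comm_monoid_add"
proof -
  have "{1..8} = {1,2,3,4,5,6,7,8::nat}" by auto
  then show ?thesis by (simp add: add.assoc)
qed

lemma dbar_gen_vvec:
  "dbar_gen 1 = smul (1/2) (gen 5 \<and>\<^sub>K gen 2)" "dbar_gen 2 = gen 5 \<and>\<^sub>K gen 3"
  "dbar_gen 3 = gen 5 \<and>\<^sub>K gen 4" "dbar_gen 4 = 0"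
proof -
  note rules = dbar_gen_def sum_1_4 lie_br_vbar_vvec om_linear om_dual smul_simps
  show "dbar_gen 1 = smul (1/2) (gen 5 \<and>\<^sub>K gen 2)" by (simp add: rules del: One_nat_def)
  show "dbar_gen 2 = gen 5 \<and>\<^sub>K gen 3" by (simp add: rules del: One_nat_def)
  show "dbar_gen 3 = gen 5 \<and>\<^sub>K gen 4" by (simp add: rules del: One_nat_def)
  show "dbar_gen 4 = 0" by (simp add: rules del: One_nat_def)
qed

lemma lie_br_vbar_vbar:
  assumes "a \<in> {1..4}" "b \<in> {1..4}"
  shows "lie_br (vbar a) (vbar b) = 0"
proof -
  have "{1..4} = {1,2,3,4::nat}" by auto
  with assms show ?thesis
    by (intro lie_eqI; auto simp: vbar_def lie_scale_def xvec_def yvec_def axis_def)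
qed

lemma dbar_gen_form:
  assumes "a > 4"
  shows "dbar_gen a = 0"
  using assms by (auto simp: dbar_gen_def lie_br_vbar_vbar om_linear smul_simps intro!: sum.neutral)

lemma gen_br_vvec_vvec:
  assumes "a \<in> {1..4}" "b \<in> {1..4}"
  shows "gen_br a b = 0"
  using assms by (simp add: gen_br_def lie_br_vvec_vvec om_linear smul_simps)

lemma gen_br_vvec_form:
  "gen_br 1 5 = 0"
  "gen_br 1 6 = smul (-1/2) (gen 5)" "gen_br 1 7 = smul (-1) (gen 6)" "gen_br 1 8 = smul (-1) (gen 7)"
  "a \<in> {2,3,4} \<Longrightarrow> b > 4 \<Longrightarrow> b \<le> 8 \<Longrightarrow> gen_br a b = 0"
proof -
  note rules = gen_br_def sum_1_4 lie_br_swap[of "vvec _" "vbar _"] lie_br_vbar_vvec om_linear om_dual smul_simps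
  show "gen_br 1 5 = 0" by (simp add: rules del: One_nat_def)
  show "gen_br 1 6 = smul (-1/2) (gen 5)" by (simp add: rules del: One_nat_def)
  show "gen_br 1 7 = smul (-1) (gen 6)" by (simp add: rules del: One_nat_def)
  show "gen_br 1 8 = smul (-1) (gen 7)" by (simp add: rules del: One_nat_def)
  show "gen_br a b = 0" if "a \<in> {2,3,4}" "b > 4" "b \<le> 8"
  proof -
    have "b - 4 \<in> {1..4}" using that by auto
    then have "ombar (b - 4) (vvec 3) = 0" "ombar (b - 4) (vvec 4) = 0"
      by (rule om_dual(4); simp)+
    with that show ?thesis
      by (auto simp: rules simp del: One_nat_def)
  qed
qed

text \<open>
  The algebraic part is \<open>g\<^sub>5 \<and> N\<close>: conjugate vectors other than \<open>vbar 1\<close> bracket the frame into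
  conjugate vectors, which the projection kills.
\<close>

lemma dbar_in_frame:
  "dbar \<alpha> = (\<Sum>j=1..4. gen (4 + j) \<and>\<^sub>K act (vbar j) \<alpha>)
     + gen 5 \<and>\<^sub>K (smul (1/2) (gen 2 \<and>\<^sub>K lcontr 1 \<alpha>) + gen 3 \<and>\<^sub>K lcontr 2 \<alpha> + gen 4 \<and>\<^sub>K lcontr 3 \<alpha>)"
  unfolding dbar_def sum_1_8
  by (simp add: dbar_gen_vvec dbar_gen_form wedge_0 wedge_smul wedge_add_right wedge_gen_gen_assoc del: One_nat_def)

lemma Pi_eq: "Pi_biv = smul 2 (blade {1,4}) + smul (-1) (blade {2,3})"
  by (simp add: Pi_biv_def gen_eq_blade wedge_gen_blade smul_simps)
    (simp add: smul_def fun_eq_iff)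

lemma rcontr_Pi:
  "rcontr Pi_biv 1 = smul (-2) (gen 4)" "rcontr Pi_biv 2 = gen 3" "rcontr Pi_biv 3 = smul (-1) (gen 2)"
  "rcontr Pi_biv 4 = smul 2 (gen 1)" "a > 4 \<Longrightarrow> rcontr Pi_biv a = 0"
  by (auto simp: Pi_eq contr_linear rcontr_blade smul_simps insert_Diff_if gen_eq_blade simp del: One_nat_def)

lemma act_Pi: "act w Pi_biv = 0"
  by (rule act_constant) (simp add: Pi_eq smul_def blade_def)

text \<open>
  The algebraic part is \<open>g\<^sub>4 \<and> L\<close>, and it comes from the term \<open>2 v\<^sub>1 \<and> v\<^sub>4\<close> alone: of the frame fields only
  \<open>v\<^sub>1\<close> has a nonzero Lie derivative on the conjugate forms.
\<close>

lemma schouten_Pi_in_frame: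
  "schouten Pi_biv \<alpha> =
     gen 4 \<and>\<^sub>K (gen 5 \<and>\<^sub>K lcontr 6 \<alpha> + smul 2 (gen 6 \<and>\<^sub>K lcontr 7 \<alpha>) + smul 2 (gen 7 \<and>\<^sub>K lcontr 8 \<alpha>))
     + (smul (-2) (gen 4 \<and>\<^sub>K act (vvec 1) \<alpha>) + gen 3 \<and>\<^sub>K act (vvec 2) \<alpha>
        + smul (-1) (gen 2 \<and>\<^sub>K act (vvec 3) \<alpha>) + smul 2 (gen 1 \<and>\<^sub>K act (vvec 4) \<alpha>))"
  unfolding schouten_def sum_1_8 sum_1_4 rcontr_Pi act_Pi
  by (simp add: rcontr_Pi gen_br_vvec_vvec gen_br_vvec_form wedge_0 wedge_smul wedge_add_right smul_simps add.assoc del: One_nat_def)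

section \<open>The filtration\<close>

lemma smooth_fun_const: "smooth_fun \<Gamma> (\<lambda>g. c)"
proof -
  have "Ck k (\<lambda>g. c)" for k c
    by (induction k arbitrary: c) (simp_all add: frechet_derivative_const)
  then show ?thesis by (simp add: smooth_fun_def)
qed

lemma smul_blade_in_Apq:
  assumes "T \<subseteq> {1..8}" "card (T \<inter> {1..4}) = p" "card (T \<inter> {5..8}) = q"
  shows "smul c (blade T) \<in> Apq \<Gamma> p q"
proof -
  have "smul c (blade T) S = (if S = T then \<lambda>g. c else (\<lambda>g. 0))" for S
    by (auto simp: smul_def blade_def)
  then show ?thesis
    using assms by (auto simp: Apq_def smooth_fun_const zero_fun_def)
qed

lemma zero_in_Apq: "0 \<in> Apq \<Gamma> p q"
  using smooth_fun_const[of \<Gamma> 0] by (simp add: Apq_def zero_fun_def)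

lemma finite_Kfilt_index: "finite {k. p \<le> int k \<and> int k \<le> n}"
  by (rule finite_subset[of _ "{..nat n}"]) auto

lemma Apq_add_in_Kfilt:
  assumes "\<alpha> \<in> Apq \<Gamma> k q" "\<alpha>' \<in> Apq \<Gamma> k' q'" "k \<noteq> k'"
    and "p \<le> int k" "p \<le> int k'" "n = int k + int q" "n = int k' + int q'"
  shows "\<alpha> + \<alpha>' \<in> Kfilt \<Gamma> p n"
proof -
  define \<beta> where "\<beta> i = (if i = k then \<alpha> else 0) + (if i = k' then \<alpha>' else 0)" for i
  have "(\<Sum>i | p \<le> int i \<and> int i \<le> n. \<beta> i) = \<alpha> + \<alpha>'"
    using assms(4-) by (simp add: \<beta>_def sum.distrib finite_Kfilt_index)
  moreover have "\<beta> i \<in> Apq \<Gamma> i (nat (n - int i))" for i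
  proof -
    have "nat (n - int k) = q" "nat (n - int k') = q'"
      using assms(6,7) by simp_all
    then show ?thesis
      using assms(1-3) by (auto simp: \<beta>_def zero_in_Apq)
  qed
  ultimately show ?thesis
    unfolding Kfilt_def by force
qed

lemma zero_in_Kfilt: "0 \<in> Kfilt \<Gamma> p n"
  unfolding Kfilt_def using zero_in_Apq by (auto intro!: exI[of _ "\<lambda>_. 0"])

lemma Apq_in_Kfilt:
  assumes "\<alpha> \<in> Apq \<Gamma> k q" "p \<le> int k" "n = int k + int q"
  shows "\<alpha> \<in> Kfilt \<Gamma> p n"
proof -
  define \<beta> where "\<beta> i = (if i = k then \<alpha> else 0)" for i
  have "(\<Sum>i | p \<le> int i \<and> int i \<le> n. \<beta> i) = \<alpha>"
    using assms(2-) by (simp add: \<beta>_def finite_Kfilt_index)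
  moreover have "\<beta> i \<in> Apq \<Gamma> i (nat (n - int i))" for i
    using assms(1,3) by (auto simp: \<beta>_def zero_in_Apq)
  ultimately show ?thesis
    unfolding Kfilt_def by force
qed

text \<open>
  The bidegree of a monomial is determined by its index set, so at most one summand of an element
  of the filtration contributes to a given coefficient.
\<close>

lemma Kfilt_coefficient:
  assumes "\<alpha> \<in> Kfilt \<Gamma> p n"
  shows "smooth_fun \<Gamma> (\<alpha> S)" and "int (card (S \<inter> {1..4})) < p \<Longrightarrow> \<alpha> S = 0"
proof -
  let ?I = "{k. p \<le> int k \<and> int k \<le> n}" and ?m = "card (S \<inter> {1..4})"
  obtain \<beta> where \<alpha>: "\<alpha> = (\<Sum>k\<in>?I. \<beta> k)" and \<beta>: "\<And>k. k \<in> ?I \<Longrightarrow> \<beta> k \<in> Apq \<Gamma> k (nat (n - int k))"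
    using assms unfolding Kfilt_def by blast
  have sum_apply: "(\<Sum>k\<in>I. \<beta> k) S = (\<Sum>k\<in>I. \<beta> k S)" for I
    by (induction I rule: infinite_finite_induct) simp_all
  have "\<beta> k S = (if k = ?m then \<beta> k S else 0)" if "k \<in> ?I" for k
    using \<beta>[OF that] unfolding Apq_def by (cases "\<beta> k S = 0") auto
  then have "\<alpha> S = (\<Sum>k\<in>?I. if k = ?m then \<beta> k S else 0)"
    unfolding \<alpha> sum_apply by (rule sum.cong[OF refl])
  also have "\<dots> = (if ?m \<in> ?I then \<beta> ?m S else 0)"
    by (simp add: finite_Kfilt_index)
  finally have coeff: "\<alpha> S = (if ?m \<in> ?I then \<beta> ?m S else 0)" .
  show "smooth_fun \<Gamma> (\<alpha> S)"
  proof (cases "?m \<in> ?I")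
    case True
    then show ?thesis
      using \<beta>[OF True] unfolding coeff Apq_def by simp
  next
    case False
    then show ?thesis
      using smooth_fun_const[of \<Gamma> 0] by (simp only: coeff if_False zero_fun_def)
  qed
  show "\<alpha> S = 0" if "int ?m < p"
    using that by (simp add: coeff)
qed

section \<open>The second differential\<close>

text \<open>
  The coefficients \<open>2\<close> and \<open>-1\<close> are chosen for holomorphy: \<open>N (2 v\<^sub>1 \<and> v\<^sub>4) = v\<^sub>2 \<and> v\<^sub>4 = N (v\<^sub>2 \<and> v\<^sub>3)\<close>.
\<close>

lemma holomorphic_poisson_Pi: "holomorphic_poisson \<Gamma> Pi_biv"
proof -
  have "Pi_biv S = (if S = {1,4} then \<lambda>g. 2 else if S = {2,3} then \<lambda>g. -1 else (\<lambda>g. 0))" for S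
  proof -
    have "{1,4} \<noteq> {2,3::nat}" by auto
    then show ?thesis by (auto simp: Pi_eq smul_def blade_def fun_eq_iff)
  qed
  then have "Pi_biv \<in> Apq \<Gamma> 2 0"
    by (auto simp: Apq_def smooth_fun_const zero_fun_def)
  moreover have "dbar Pi_biv = 0"
    unfolding dbar_in_frame act_Pi
    by (simp add: wedge_0 Pi_eq contr_linear lcontr_blade gen_eq_blade insert_Diff_if
        wedge_gen_blade smul_simps insert_commute wedge_smul wedge_add_right)
      (simp add: smul_def fun_eq_iff)
  moreover have "schouten Pi_biv Pi_biv = 0"
    unfolding schouten_Pi_in_frame act_Pi
    by (simp add: wedge_0 Pi_eq contr_linear lcontr_blade smul_simps)
  ultimately show ?thesis
    by (simp add: holomorphic_poisson_def)
qed

abbreviation total_diff :: "kfield \<Rightarrow> kfield" where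
  "total_diff \<alpha> \<equiv> schouten Pi_biv \<alpha> + dbar \<alpha>"

lemma total_diff_0: "total_diff 0 = 0"
  by (simp add: schouten_Pi_in_frame dbar_in_frame contr_linear act_0 wedge_0 smul_simps)

text \<open>
  The \<open>\<partial>\<close>-bar closed element \<open>g\<^sub>6 \<and> g\<^sub>7\<close> of \<open>A\<^sup>0\<^sup>,\<^sup>2\<close> together with the correction \<open>g\<^sub>3 \<and> g\<^sub>7\<close> in \<open>A\<^sup>1\<^sup>,\<^sup>1\<close> which
  moves its differential two steps up in the filtration.
\<close>

definition zigzag :: kfield where
  "zigzag = blade {6,7} + blade {3,7}"

lemma total_diff_zigzag: "total_diff zigzag = smul (-2) (blade {3,4,6})"
proof -
  have "act w zigzag = 0" for w
    by (rule act_constant) (simp add: zigzag_def blade_def)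
  then show ?thesis
    unfolding schouten_Pi_in_frame dbar_in_frame
    by (simp add: zigzag_def wedge_0 contr_linear lcontr_blade gen_eq_blade insert_Diff_if
        wedge_gen_blade wedge_add_right smul_simps insert_commute wedge_smul)
      (simp add: smul_def fun_eq_iff)
qed

text \<open>
  The only coefficient of \<open>b\<close> that enters both formulas undifferentiated is the one of \<open>g\<^sub>3 \<and> g\<^sub>7\<close>: it is
  carried by \<open>g\<^sub>4 \<and> L\<close> to \<open>g\<^sub>3 \<and> g\<^sub>4 \<and> g\<^sub>6\<close> and by \<open>g\<^sub>5 \<and> N\<close> to \<open>g\<^sub>4 \<and> g\<^sub>5 \<and> g\<^sub>7\<close>.  The hypotheses of the second
  formula say that \<open>b\<close> has no component in \<open>A\<^sup>0\<^sup>,\<^sup>2\<close> that could contribute.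
\<close>

lemma total_diff_coefficients:
  shows "total_diff b {3,4,6} g = - 2 * b {3,7} g + 2 * cderiv (vvec 1) (b {3,6}) g
      + cderiv (vvec 2) (b {4,6}) g + cderiv (vbar 2) (b {3,4}) g"
    and "b {6,7} = 0 \<Longrightarrow> b {5,8} = 0 \<Longrightarrow> b {5,7} = 0 \<Longrightarrow>
      total_diff b {4,5,7} g = - b {3,7} g - cderiv (vbar 1) (b {4,7}) g + cderiv (vbar 3) (b {4,5}) g"
  unfolding schouten_Pi_in_frame dbar_in_frame sum_1_4
  by (simp_all add: wedge_gen_apply lcontr_apply act_def smul_def insert_Diff_if insert_commute cderiv_0)

text \<open>
  By the coefficient of \<open>g\<^sub>4 \<and> g\<^sub>5 \<and> g\<^sub>7\<close>, the function \<open>b {3,7}\<close> is a sum of left-invariant derivatives;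
  by the coefficient of \<open>g\<^sub>3 \<and> g\<^sub>4 \<and> g\<^sub>6\<close>, so is then the constant \<open>-2\<close>.
\<close>

lemma zigzag_not_boundary:
  assumes \<Gamma>: "cocompact_lattice \<Gamma>"
    and a: "a \<in> Kfilt \<Gamma> 3 n" and b: "b \<in> Kfilt \<Gamma> 1 m" and Db: "total_diff b \<in> Kfilt \<Gamma> 2 n"
  shows "total_diff zigzag \<noteq> a + total_diff b"
proof
  assume eq: "total_diff zigzag = a + total_diff b"
  note null = mean_null_cderiv[OF \<Gamma> Kfilt_coefficient(1)[OF b]]
  have vanish: "b {6,7} = 0" "b {5,8} = 0" "b {5,7} = 0" "total_diff b {4,5,7} = 0" "a {3,4,6} = 0"
    by (rule Kfilt_coefficient(2)[OF b] Kfilt_coefficient(2)[OF Db] Kfilt_coefficient(2)[OF a]; simp)+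
  have b37: "b {3,7} g = (-1) * cderiv (vbar 1) (b {4,7}) g + cderiv (vbar 3) (b {4,5}) g" for g
  proof -
    have "total_diff b {4,5,7} g = 0"
      unfolding vanish by simp
    then show ?thesis
      unfolding total_diff_coefficients(2)[OF vanish(1-3)] by (simp add: algebra_simps)
  qed
  have "(- 2 :: complex) = (- 2) * ((-1) * cderiv (vbar 1) (b {4,7}) g + cderiv (vbar 3) (b {4,5}) g)
      + 2 * cderiv (vvec 1) (b {3,6}) g + cderiv (vvec 2) (b {4,6}) g + cderiv (vbar 2) (b {3,4}) g" for g
  proof -
    have "- 2 = total_diff zigzag {3,4,6} g"
      unfolding total_diff_zigzag by (simp add: smul_def blade_def)
    also have "\<dots> = a {3,4,6} g + total_diff b {3,4,6} g"
      unfolding eq by simp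
    also have "a {3,4,6} g = 0"
      unfolding vanish by simp
    finally show ?thesis
      unfolding total_diff_coefficients(1) b37 by simp
  qed
  then have const: "(\<lambda>g. (- 2 :: complex)) = (\<lambda>g. (- 2) * ((-1) * cderiv (vbar 1) (b {4,7}) g
      + cderiv (vbar 3) (b {4,5}) g)
      + 2 * cderiv (vvec 1) (b {3,6}) g + cderiv (vvec 2) (b {4,6}) g + cderiv (vbar 2) (b {3,4}) g)"
    by (rule ext)
  have "bch.mean_null (\<lambda>g. - 2 :: complex)"
    unfolding const by (intro bch.mean_null_add bch.mean_null_mult null)
  then show False
    using bch.mean_null_const[of "- 2 :: complex"] by simp
qed

theorem proposition3:
  fixes \<Gamma> :: "real lie set"
  assumes "cocompact_lattice \<Gamma>"
  shows "holomorphic_poisson \<Gamma> Pi_biv \<and> \<not> poisson_degenerates_at \<Gamma> Pi_biv 2"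
proof
  show "holomorphic_poisson \<Gamma> Pi_biv"
    by (rule holomorphic_poisson_Pi)
  let ?F = "Kfilt \<Gamma>" and ?D = "\<lambda>\<alpha>. total_diff \<alpha>"
  show "\<not> poisson_degenerates_at \<Gamma> Pi_biv 2"
  proof
    assume "poisson_degenerates_at \<Gamma> Pi_biv 2"
    then have deg: "ss_d ?F ?D 2 0 2 C = ss_class ?F ?D 2 2 1 0" if "C \<in> ss_E ?F ?D 2 0 2" for C
      using that unfolding poisson_degenerates_at_def ss_degenerates_at_def by force
    have D0: "?D 0 = 0"
      by (rule total_diff_0)
    have zero_B: "0 \<in> ss_B ?F ?D r p q" for r p q
      unfolding ss_B_def ss_Z_def by (auto intro!: exI[of _ 0] simp: zero_in_Kfilt D0)
    have class_self: "x \<in> ss_class ?F ?D r p q x" for r p q x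
      unfolding ss_class_def using zero_B by force
    have "blade {6,7} + blade {3,7} \<in> ?F 0 2"
      using smul_blade_in_Apq[of "{6,7}" 0 2 1 \<Gamma>] smul_blade_in_Apq[of "{3,7}" 1 1 1 \<Gamma>]
      by (intro Apq_add_in_Kfilt[of _ _ 0 2 _ 1 1]) (simp_all add: smul_simps)
    moreover have "?D zigzag \<in> ?F 2 3"
      using smul_blade_in_Apq[of "{3,4,6}" 2 1 "-2" \<Gamma>] unfolding total_diff_zigzag
      by (intro Apq_in_Kfilt[of _ _ 2 1]) simp_all
    ultimately have "zigzag \<in> ss_Z ?F ?D 2 0 2"
      by (simp add: ss_Z_def zigzag_def)
    then have "ss_class ?F ?D 2 0 2 zigzag \<in> ss_E ?F ?D 2 0 2"
      unfolding ss_E_def by (rule imageI)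
    \<comment> \<open>The differential \<open>d\<^sub>2\<close> of a class is a union over its representatives, one of which is \<open>zigzag\<close>.\<close>
    from deg[OF this] have "?D zigzag \<in> ss_class ?F ?D 2 2 1 0"
      using class_self[of zigzag 2 0 2] class_self[of "?D zigzag" 2 2 1] by (auto simp: ss_d_def)
    then obtain a b where "?D zigzag = a + ?D b" "a \<in> ?F 3 3" "b \<in> ?F 1 2" "?D b \<in> ?F 2 3"
      unfolding ss_class_def ss_B_def ss_Z_def by auto
    with zigzag_not_boundary[OF assms] show False
      by blast
  qed
qed

end
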